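(* For $k\ge 0$ let $K_k$ denote the number of isomorphism classes of rooted oriented Reeb graphs with $k$ saddles. Then $K_0=1$, and the numbers $K_k$ satisfy the following recursive formulas: for even $k=2n$ with $n\ge 1$, $$K_{2n}=3\left(K_0K_{2n-1}+K_1K_{2n-2}+\ldots+K_{n-1}K_n\right)=3\sum_{i=0}^{n-1}K_iK_{2n-1-i};$$ for odd $k=2n+1$ with $n\ge 0$, $$K_{2n+1}=3\left(K_0K_{2n}+K_1K_{2n-1}+\ldots+K_{n-1}K_{n+1}\right)+\frac{3K_n^2+K_n}{2}=3\sum_{i=0}^{n-1}K_iK_{2n-i}+\frac{3K_n^2+K_n}{2},$$ where an empty sum is $0$.
   Context: A rooted oriented Reeb graph with $k$ saddles is a finite oriented tree (a finite tree with a direction chosen on every edge) together with a distinguished vertex, the root, such that: the root has degree 1; every other vertex has degree 1 or 3; there are exactly $k$ vertices of degree 3 (called saddles); no vertex of degree 3 is a sink or a source (i.e. at each such vertex there is at least one incoming and at least one outgoing edge); and the edge incident to the root is directed away from the root. Two such graphs are isomorphic if there is an isomorphism of oriented graphs between them that maps root to root. (For $k=0$ the only such graph is a single edge directed from the root to the other vertex.) *)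

theory Defs
  imports Complex_Main "Graph_Theory.Graph_Theory"
begin

text \<open>
  Digraphs are taken without parallel arcs (type \<open>pair_pre_digraph\<close>); a tree has none anyway.
  The constant \<open>tree\<close> of \<open>Digraph_Component\<close> only forbids directed cycles, so it does not describe
  oriented trees. Here the cycles of the underlying undirected graph are the cycles of length at
  least 3 of the symmetric closure \<open>mk_symmetric G\<close>: the length bound discards the closed walks
  \<open>u, v, u\<close> that traverse one edge back and forth.
\<close>

locale oriented_tree = pair_digraph G for G :: "'a pair_pre_digraph" +
  assumes one_direction: "(u, v) \<in> parcs G \<Longrightarrow> (v, u) \<notin> parcs G"
    and underlying_connected: "Digraph_Component.connected (with_proj G)"
    and underlying_acyclic:
      "\<not> (\<exists>p. pre_digraph.cycle (with_proj (mk_symmetric (with_proj G))) p \<and> 3 \<le> length p)"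

definition degree :: "'a pair_pre_digraph \<Rightarrow> 'a \<Rightarrow> nat" where
  "degree G v = in_degree (with_proj G) v + out_degree (with_proj G) v"

definition saddles :: "'a pair_pre_digraph \<Rightarrow> 'a set" where
  "saddles G = {v \<in> pverts G. degree G v = 3}"

locale rooted_oriented_reeb_graph = oriented_tree G for G :: "'a pair_pre_digraph" +
  fixes root :: 'a
  assumes root_in_verts: "root \<in> pverts G"
    and degree_root: "degree G root = 1"
    and degree_other: "v \<in> pverts G \<Longrightarrow> v \<noteq> root \<Longrightarrow> degree G v = 1 \<or> degree G v = 3"
    and saddle_not_source: "v \<in> saddles G \<Longrightarrow> 1 \<le> in_degree (with_proj G) v"
    and saddle_not_sink: "v \<in> saddles G \<Longrightarrow> 1 \<le> out_degree (with_proj G) v"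
    and root_edge_outgoing: "e \<in> parcs G \<Longrightarrow> fst e = root \<or> snd e = root \<Longrightarrow> fst e = root"

definition rooted_iso ::
  "'a pair_pre_digraph \<Rightarrow> 'a \<Rightarrow> 'b pair_pre_digraph \<Rightarrow> 'b \<Rightarrow> bool" where
  "rooted_iso G r H s \<longleftrightarrow>
    (\<exists>f. pre_digraph.digraph_isomorphism (with_proj G) f \<and>
         with_proj H = app_iso f (with_proj G) \<and> iso_verts f r = s)"

lemma rooted_iso_iff:
  assumes "pair_wf_digraph G"
  shows "rooted_iso G r H s \<longleftrightarrow>
    (\<exists>\<phi>. bij_betw \<phi> (pverts G) (pverts H) \<and> parcs H = map_prod \<phi> \<phi> ` parcs G \<and> \<phi> r = s)"
proof
  interpret pair_wf_digraph G by fact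
  assume "rooted_iso G r H s"
  then obtain f where f: "pre_digraph.digraph_isomorphism (with_proj G) f"
    "with_proj H = app_iso f (with_proj G)" "iso_verts f r = s"
    unfolding rooted_iso_def by blast
  from f(2) have eq: "pverts H = iso_verts f ` pverts G" "parcs H = iso_arcs f ` parcs G"
    "iso_tail f = fst" "iso_head f = snd"
    by (auto simp: with_proj_def app_iso_def)
  have "iso_arcs f e = map_prod (iso_verts f) (iso_verts f) e" if "e \<in> parcs G" for e
    using f(1) that unfolding pre_digraph.digraph_isomorphism_def eq
    by (simp add: prod_eq_iff)
  then have "parcs H = map_prod (iso_verts f) (iso_verts f) ` parcs G"
    unfolding eq by (rule image_cong[OF refl])
  moreover have "bij_betw (iso_verts f) (pverts G) (pverts H)"
    using f(1) eq unfolding pre_digraph.digraph_isomorphism_def bij_betw_def by simp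
  ultimately show "\<exists>\<phi>. bij_betw \<phi> (pverts G) (pverts H) \<and>
      parcs H = map_prod \<phi> \<phi> ` parcs G \<and> \<phi> r = s"
    using f(3) by blast
next
  interpret pair_wf_digraph G by fact
  assume "\<exists>\<phi>. bij_betw \<phi> (pverts G) (pverts H) \<and>
      parcs H = map_prod \<phi> \<phi> ` parcs G \<and> \<phi> r = s"
  then obtain \<phi> where \<phi>: "inj_on \<phi> (pverts G)" "pverts H = \<phi> ` pverts G"
    "parcs H = map_prod \<phi> \<phi> ` parcs G" "\<phi> r = s"
    by (auto simp: bij_betw_def)
  let ?f = "\<lparr>iso_verts = \<phi>, iso_arcs = map_prod \<phi> \<phi>, iso_head = snd, iso_tail = fst\<rparr>"
  have "parcs G \<subseteq> pverts G \<times> pverts G"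
    by (auto dest: in_arcsD1 in_arcsD2)
  then have "inj_on (map_prod \<phi> \<phi>) (parcs G)"
    using map_prod_inj_on[OF \<phi>(1) \<phi>(1)] inj_on_subset by blast
  then have "pre_digraph.digraph_isomorphism (with_proj G) ?f"
    using \<phi> assms unfolding pre_digraph.digraph_isomorphism_def
    by (simp add: wf_digraph_wp_iff)
  moreover have "with_proj H = app_iso ?f (with_proj G)"
    using \<phi> by (simp add: with_proj_def app_iso_def)
  ultimately show "rooted_iso G r H s"
    unfolding rooted_iso_def using \<phi>(4) by force
qed

text \<open>Every finite graph has a copy with vertices in \<open>nat\<close>, so \<open>nat\<close> vertices represent every
  isomorphism class.\<close>

definition reeb_graphs :: "nat \<Rightarrow> (nat pair_pre_digraph \<times> nat) set" where
  "reeb_graphs k = {(G, r). rooted_oriented_reeb_graph G r \<and> card (saddles G) = k}"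

definition reeb_iso_rel ::
  "nat \<Rightarrow> ((nat pair_pre_digraph \<times> nat) \<times> (nat pair_pre_digraph \<times> nat)) set" where
  "reeb_iso_rel k =
    {((G, r), (H, s)). (G, r) \<in> reeb_graphs k \<and> (H, s) \<in> reeb_graphs k \<and> rooted_iso G r H s}"

lemma equiv_reeb_iso_rel: "equiv (reeb_graphs k) (reeb_iso_rel k)"
proof -
  have wf: "pair_wf_digraph G" if "(G, r) \<in> reeb_graphs k" for G r
    using that unfolding reeb_graphs_def rooted_oriented_reeb_graph_def oriented_tree_def
      pair_digraph_def pair_fin_digraph_def by blast
  have root: "r \<in> pverts G" if "(G, r) \<in> reeb_graphs k" for G r
    using that by (auto simp: reeb_graphs_def intro: rooted_oriented_reeb_graph.root_in_verts)
  have refl: "rooted_iso G r G r" if "(G, r) \<in> reeb_graphs k" for G r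
    unfolding rooted_iso_iff[OF wf[OF that]]
    by (rule exI[of _ id]) (auto simp: map_prod.id)
  have sym: "rooted_iso H s G r"
    if *: "(G, r) \<in> reeb_graphs k" "(H, s) \<in> reeb_graphs k" "rooted_iso G r H s" for G r H s
  proof -
    obtain \<phi> where \<phi>: "bij_betw \<phi> (pverts G) (pverts H)" "parcs H = map_prod \<phi> \<phi> ` parcs G"
      "\<phi> r = s"
      using *(3) unfolding rooted_iso_iff[OF wf[OF *(1)]] by blast
    let ?\<psi> = "the_inv_into (pverts G) \<phi>"
    have inj: "inj_on \<phi> (pverts G)" using \<phi>(1) by (rule bij_betw_imp_inj_on)
    have "map_prod ?\<psi> ?\<psi> (map_prod \<phi> \<phi> e) = e" if "e \<in> parcs G" for e
      using that pair_wf_digraph.arc_fst_in_verts[OF wf[OF *(1)]]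
        pair_wf_digraph.arc_snd_in_verts[OF wf[OF *(1)]]
      by (simp add: prod_eq_iff the_inv_into_f_f[OF inj])
    then have "parcs G = map_prod ?\<psi> ?\<psi> ` parcs H"
      unfolding \<phi>(2) image_image by simp
    moreover have "?\<psi> s = r"
      using the_inv_into_f_f[OF inj root[OF *(1)]] \<phi>(3) by simp
    ultimately show ?thesis
      unfolding rooted_iso_iff[OF wf[OF *(2)]] using bij_betw_the_inv_into[OF \<phi>(1)] by blast
  qed
  have trans: "rooted_iso G r I t"
    if *: "(G, r) \<in> reeb_graphs k" "(H, s) \<in> reeb_graphs k"
      "rooted_iso G r H s" "rooted_iso H s I t" for G r H s I t
  proof -
    obtain \<phi> where \<phi>: "bij_betw \<phi> (pverts G) (pverts H)" "parcs H = map_prod \<phi> \<phi> ` parcs G"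
      "\<phi> r = s"
      using *(3) unfolding rooted_iso_iff[OF wf[OF *(1)]] by blast
    obtain \<psi> where \<psi>: "bij_betw \<psi> (pverts H) (pverts I)" "parcs I = map_prod \<psi> \<psi> ` parcs H"
      "\<psi> s = t"
      using *(4) unfolding rooted_iso_iff[OF wf[OF *(2)]] by blast
    have "parcs I = map_prod (\<psi> \<circ> \<phi>) (\<psi> \<circ> \<phi>) ` parcs G"
      unfolding \<psi>(2) \<phi>(2) image_image by (intro image_cong) auto
    moreover have "(\<psi> \<circ> \<phi>) r = t"
      using \<phi>(3) \<psi>(3) by simp
    ultimately show ?thesis
      unfolding rooted_iso_iff[OF wf[OF *(1)]] using bij_betw_trans[OF \<phi>(1) \<psi>(1)] by blast
  qed
  show ?thesis
  proof (rule equivI)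
    show "reeb_iso_rel k \<subseteq> reeb_graphs k \<times> reeb_graphs k"
      unfolding reeb_iso_rel_def by auto
    show "refl_on (reeb_graphs k) (reeb_iso_rel k)"
      using refl by (auto simp: refl_on_def reeb_iso_rel_def)
    show "sym (reeb_iso_rel k)"
      by (rule symI) (auto simp: reeb_iso_rel_def intro: sym)
    show "trans (reeb_iso_rel k)"
      by (rule transI) (auto simp: reeb_iso_rel_def intro: trans)
  qed
qed

text \<open>The convention that infinite sets have cardinality 0 is harmless for the recursion:
  together with \<open>K 0 = 1\<close> it forces every \<open>K k\<close> to be positive, hence every set of classes
  to be finite.\<close>

definition K :: "nat \<Rightarrow> nat" where
  "K k = card (reeb_graphs k // reeb_iso_rel k)"

end

theory Submission
  imports Defs "HOL-Library.Multiset"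
begin

text \<open>Cut a rooted Reeb graph with \<open>k + 1\<close> saddles at the saddle next to the root. Besides the edge
  from the root it carries two branches with \<open>k\<close> saddles in total, at least one of which starts
  with an outgoing edge. If the other one is incoming, the branches are distinguishable, and
  reversing all edges identifies incoming branches with rooted Reeb graphs, so there are
  \<open>\<Sum>i\<le>k. K i * K (k - i)\<close> cases. If both are outgoing, the branches form an unordered pair, and
  twice the number of unordered pairs is the number of ordered pairs plus the number of diagonal
  ones. Hence \<open>2 * K (k + 1) = 3 * (\<Sum>i\<le>k. K i * K (k - i)) + d\<close> where \<open>d\<close> is \<open>K (k / 2)\<close> for
  even \<open>k\<close> and \<open>0\<close> otherwise. Isomorphism classes are counted through codes, which record the
  recursive decomposition up to exchange of the branches.\<close>

section \<open>Trees as connected graphs all of whose edges are bridges\<close>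

text \<open>Replaces the absence of undirected cycles: reachability passes to subgraphs and unions
  more easily than cycles given as arc lists. Loops and antiparallel pairs are excluded as well,
  since the ends of such an arc stay connected without it.\<close>

definition bridged :: "'a rel \<Rightarrow> bool" where
  "bridged A \<longleftrightarrow> (\<forall>u v. (u, v) \<in> A \<longrightarrow> (u, v) \<notin> (symcl (A - {(u, v)}))\<^sup>*)"

lemma symcl_iff: "(x, y) \<in> symcl A \<longleftrightarrow> (x, y) \<in> A \<or> (y, x) \<in> A"
  by (auto simp: symcl_def)

lemma sym_symcl: "sym (symcl A)"
  by (auto simp: sym_def symcl_iff)

lemma rtrancl_symcl_commute: "(x, y) \<in> (symcl A)\<^sup>* \<Longrightarrow> (y, x) \<in> (symcl A)\<^sup>*"
  using sym_rtrancl[OF sym_symcl] by (rule symD)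

lemma symcl_Image: "symcl R `` {x} = R `` {x} \<union> R\<inverse> `` {x}"
  by (auto simp: symcl_iff)

lemma symcl_mono: "A \<subseteq> B \<Longrightarrow> symcl A \<subseteq> symcl B"
  by (auto simp: symcl_def)

lemma bridged_not_refl: "bridged A \<Longrightarrow> (u, u) \<notin> A"
  by (auto simp: bridged_def)

lemma bridged_one_direction:
  assumes "bridged A" "(u, v) \<in> A" shows "(v, u) \<notin> A"
proof
  assume "(v, u) \<in> A"
  moreover have "u \<noteq> v" using assms bridged_not_refl by metis
  ultimately have "(u, v) \<in> symcl (A - {(u, v)})" by (simp add: symcl_iff)
  then show False using assms by (auto simp: bridged_def)
qed

lemma bridged_mono: "bridged A \<Longrightarrow> B \<subseteq> A \<Longrightarrow> bridged B"
  unfolding bridged_def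
  using rtrancl_mono[OF symcl_mono[of "B - {e}" "A - {e}" for e]] by blast

section \<open>Detours and undirected cycles\<close>

lemma pcas_first_in_pawalk_verts: "pcas b p a \<Longrightarrow> b \<in> set (pawalk_verts b p)"
  by (cases p) auto

lemma pcas_arc_in_pawalk_verts:
  assumes "pcas b p a" "e \<in> set p"
  shows "fst e \<in> set (pawalk_verts b p)" "snd e \<in> set (pawalk_verts b p)"
  using assms by (induction b p a rule: pcas.induct) (auto dest: pcas_first_in_pawalk_verts)

lemma pcas_last_in_pawalk_verts: "pcas b p a \<Longrightarrow> a \<in> set (pawalk_verts b p)"
  by (induction b p a rule: pcas.induct) auto

lemma pcas_rtrancl: "pcas b p a \<Longrightarrow> set p \<subseteq> R \<Longrightarrow> (b, a) \<in> R\<^sup>*"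
  by (induction b p a rule: pcas.induct)
    (auto intro: converse_rtrancl_into_rtrancl)

text \<open>The path starts at \<open>b\<close> and never returns there, so only its first arc could
  join \<open>a\<close> and \<open>b\<close>. The path would then already be in \<open>a\<close>,
  and its remaining arcs would lead back to \<open>a\<close>, a repetition.\<close>

lemma path_avoids_closing_edge:
  assumes "pcas b q a" "distinct (pawalk_verts b q)" "2 \<le> length q"
  shows "(a, b) \<notin> set q" "(b, a) \<notin> set q"
proof -
  obtain c q' where q: "q = (b, c) # q'" "pcas c q' a" "q' \<noteq> []"
    using assms by (cases q) (auto simp: Suc_le_eq)
  have notin: "b \<notin> set (pawalk_verts c q')" and d: "distinct (pawalk_verts c q')"
    using assms(2) q by auto
  have tail: "(a, b) \<notin> set q'" "(b, a) \<notin> set q'"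
    using notin pcas_arc_in_pawalk_verts[OF q(2)] by fastforce+
  have "c \<noteq> a"
  proof
    assume "c = a"
    moreover obtain e q'' where "q' = e # q''" using q(3) by (cases q') auto
    ultimately show False
      using q(2) d pcas_last_in_pawalk_verts[of "snd e" q'' a] by simp
  qed
  moreover have "c \<noteq> b"
    using notin by (cases q') (use q in auto)
  ultimately show "(a, b) \<notin> set q" "(b, a) \<notin> set q"
    using tail q(1) by auto
qed

context pair_wf_digraph
begin

lemma parcs_symmetric: "parcs (mk_symmetric (with_proj G)) = symcl (parcs G)"
  by (auto simp: parcs_mk_symmetric symcl_def)

text \<open>A detour around an arc, shortened to a path, closes up with the arc to a cycle.
  Hypothesis \<open>one\<close> rules out that the detour is just the reversed arc, which would give
  a closed walk of length 2 only.\<close>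

lemma bridged_if_acyclic:
  assumes one: "\<And>u v. (u, v) \<in> parcs G \<Longrightarrow> (v, u) \<notin> parcs G"
    and acyc: "\<not> (\<exists>p. pre_digraph.cycle (with_proj (mk_symmetric (with_proj G))) p \<and> 3 \<le> length p)"
  shows "bridged (parcs G)"
  unfolding bridged_def
proof (intro allI impI notI)
  fix u v
  assume uv: "(u, v) \<in> parcs G" and conn: "(u, v) \<in> (symcl (parcs G - {(u, v)}))\<^sup>*"
  let ?H = "\<lparr>pverts = pverts G, parcs = symcl (parcs G - {(u, v)})\<rparr>"
  interpret H: pair_wf_digraph ?H
    by unfold_locales (auto simp: symcl_def in_arcsD1 in_arcsD2)
  interpret S: pair_wf_digraph "mk_symmetric (with_proj G)"
    by (rule wellformed_mk_symmetric)
  have "(u, w) \<in> rtrancl_on (pverts G) (parcs ?H)" if "(u, w) \<in> (parcs ?H)\<^sup>*" for w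
    using that in_arcsD1[OF uv] H.in_arcsD2
    by (induction rule: rtrancl_induct) (auto intro: rtrancl_on_into_rtrancl_on)
  then have "(u, v) \<in> rtrancl_on (pverts G) (symcl (parcs G - {(u, v)}))"
    using conn by simp
  then obtain p where p: "H.apath u p v"
    using H.reachable_apath by (auto simp: reachable_def)
  then have cas: "pcas u p v" and dist: "distinct (pawalk_verts u p)"
    and sub: "set p \<subseteq> symcl (parcs G - {(u, v)})"
    by (auto simp: H.apath_def H.awalk_def)
  have "u \<noteq> v" using one uv by blast
  have "2 \<le> length p"
  proof (rule ccontr)
    assume "\<not> 2 \<le> length p"
    then consider "p = []" | e where "p = [e]" by (cases p) (auto simp: Suc_le_eq)
    then show False
    proof cases
      case 1 then show False using cas \<open>u \<noteq> v\<close> by simp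
    next
      case (2 e)
      then have "e = (u, v)" using cas by (cases e) auto
      then show False using 2 sub one[OF uv] by (auto simp: symcl_iff)
    qed
  qed
  moreover have "S.cycle ((v, u) # p)"
    unfolding S.cycle_def S.awalk_def
  proof (intro exI[of _ v] conjI)
    show "set ((v, u) # p) \<subseteq> parcs (mk_symmetric (with_proj G))"
      using sub uv symcl_mono[of "parcs G - {(u, v)}" "parcs G"]
      by (auto simp: parcs_symmetric symcl_iff)
  qed (use cas dist in_arcsD2[OF uv] in simp_all)
  ultimately show False using acyc by fastforce
qed

text \<open>Dropping the first edge of a long cycle leaves a path that avoids this edge in both
  directions, hence a detour around it. The cycle runs in the symmetric closure, so either
  orientation of the edge may be the arc of \<open>G\<close>.\<close>

lemma acyclic_if_bridged:
  assumes "bridged (parcs G)"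
    and "pre_digraph.cycle (with_proj (mk_symmetric (with_proj G))) p"
  shows "length p < 3"
proof (rule ccontr)
  assume len: "\<not> length p < 3"
  interpret S: pair_wf_digraph "mk_symmetric (with_proj G)"
    by (rule wellformed_mk_symmetric)
  obtain a where a: "set p \<subseteq> symcl (parcs G)" "pcas a p a" "distinct (tl (pawalk_verts a p))"
    using assms(2) by (auto simp: S.cycle_def S.awalk_def parcs_symmetric)
  obtain b q where p: "p = (a, b) # q" using len a(2) by (cases p) auto
  have q: "pcas b q a" "distinct (pawalk_verts b q)" "2 \<le> length q" "set q \<subseteq> symcl (parcs G)"
    using a len p by auto
  have "set q \<subseteq> symcl (parcs G) - {(a, b), (b, a)}"
    using q path_avoids_closing_edge[OF q(1-3)] by auto
  then have *: "(b, a) \<in> (symcl (parcs G) - {(a, b), (b, a)})\<^sup>*"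
    by (rule pcas_rtrancl[OF q(1)])
  have "symcl (parcs G) - {(a, b), (b, a)} \<subseteq> symcl (parcs G - {e})" if "e = (a, b) \<or> e = (b, a)" for e
    using that by (auto simp: symcl_iff)
  then have **: "(b, a) \<in> (symcl (parcs G - {e}))\<^sup>*" if "e = (a, b) \<or> e = (b, a)" for e
    using * rtrancl_mono that by blast
  have "(a, b) \<in> parcs G \<or> (b, a) \<in> parcs G"
    using a(1) p by (auto simp: symcl_iff)
  then show False
    using assms(1) ** rtrancl_symcl_commute unfolding bridged_def by metis
qed

lemma connected_iff_rtrancl:
  "Digraph_Component.connected (with_proj G) \<longleftrightarrow>
    pverts G \<noteq> {} \<and> (\<forall>u\<in>pverts G. \<forall>v\<in>pverts G. (u, v) \<in> (symcl (parcs G))\<^sup>*)"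
proof -
  interpret S: pair_wf_digraph "mk_symmetric (with_proj G)"
    by (rule wellformed_mk_symmetric)
  have "u \<rightarrow>\<^sup>*\<^bsub>mk_symmetric (with_proj G)\<^esub> v \<longleftrightarrow> (u, v) \<in> (symcl (parcs G))\<^sup>*"
    if "u \<in> pverts G" for u v
  proof
    assume "u \<rightarrow>\<^sup>*\<^bsub>mk_symmetric (with_proj G)\<^esub> v"
    then show "(u, v) \<in> (symcl (parcs G))\<^sup>*"
      by (auto dest: reachable_rtranclI simp: parcs_symmetric)
  next
    assume "(u, v) \<in> (symcl (parcs G))\<^sup>*"
    then show "u \<rightarrow>\<^sup>*\<^bsub>mk_symmetric (with_proj G)\<^esub> v"
      unfolding reachable_def using that S.in_arcsD2
      by (induction rule: rtrancl_induct)
        (auto simp: parcs_symmetric intro: rtrancl_on_into_rtrancl_on)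
  qed
  then show ?thesis by (auto simp: connected_def strongly_connected_def)
qed

end

section \<open>Reeb graphs as bare vertex and arc sets\<close>

definition deg :: "'a rel \<Rightarrow> 'a \<Rightarrow> nat" where
  "deg A x = card (A `` {x}) + card (A\<inverse> `` {x})"

text \<open>The flag \<open>b\<close> tells whether the root edge is directed away from the root. Both values are
  needed, since branches of a Reeb graph may be attached by an edge towards their root.\<close>

definition planted_reeb :: "bool \<Rightarrow> 'a set \<Rightarrow> 'a rel \<Rightarrow> 'a \<Rightarrow> bool" where
  "planted_reeb b V A r \<longleftrightarrow> finite V \<and> A \<subseteq> V \<times> V \<and> bridged A \<and>
    (\<forall>x\<in>V. \<forall>y\<in>V. (x, y) \<in> (symcl A)\<^sup>*) \<and> r \<in> V \<and> deg A r = 1 \<and>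
    (\<forall>x\<in>V. x \<noteq> r \<longrightarrow> deg A x = 1 \<or> deg A x = 3) \<and>
    (\<forall>x\<in>V. deg A x = 3 \<longrightarrow> A `` {x} \<noteq> {} \<and> A\<inverse> `` {x} \<noteq> {}) \<and>
    (\<exists>v. (if b then (r, v) else (v, r)) \<in> A)"

lemma in_degree_eq: "in_degree (with_proj G) v = card ((parcs G)\<inverse> `` {v})"
  unfolding in_degree_def in_arcs_def
  by (rule bij_betw_same_card[of fst]) (auto simp: bij_betw_def inj_on_def image_iff)

lemma out_degree_eq: "out_degree (with_proj G) v = card (parcs G `` {v})"
  unfolding out_degree_def out_arcs_def
  by (rule bij_betw_same_card[of snd]) (auto simp: bij_betw_def inj_on_def image_iff)

lemma degree_eq_deg: "degree G v = deg (parcs G) v"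
  by (simp add: degree_def deg_def in_degree_eq out_degree_eq)

lemma deg_1_neighbour_unique:
  assumes "finite A" "deg A r = 1" "(r, v) \<in> A \<or> (v, r) \<in> A"
    "(r, w) \<in> A \<or> (w, r) \<in> A"
  shows "v = w" "(r, v) \<in> A \<Longrightarrow> (w, r) \<notin> A"
proof -
  have fin: "finite (A `` {r})" "finite (A\<inverse> `` {r})"
    using assms(1) by (simp_all add: finite_Image)
  consider "card (A `` {r}) = 1" "card (A\<inverse> `` {r}) = 0" | "card (A `` {r}) = 0" "card (A\<inverse> `` {r}) = 1"
    using assms(2) unfolding deg_def by linarith
  then have "v = w \<and> ((r, v) \<in> A \<longrightarrow> (w, r) \<notin> A)"
  proof cases
    case 1
    then obtain z where "A `` {r} = {z}" "A\<inverse> `` {r} = {}"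
      using fin by (auto simp: card_1_singleton_iff)
    then have "(r, x) \<in> A \<longleftrightarrow> x = z" "(x, r) \<notin> A" for x by auto
    then show ?thesis using assms(3,4) by simp
  next
    case 2
    then obtain z where "A\<inverse> `` {r} = {z}" "A `` {r} = {}"
      using fin by (auto simp: card_1_singleton_iff)
    then have "(x, r) \<in> A \<longleftrightarrow> x = z" "(r, x) \<notin> A" for x by auto
    then show ?thesis using assms(3,4) by simp
  qed
  then show "v = w" "(r, v) \<in> A \<Longrightarrow> (w, r) \<notin> A" by auto
qed

text \<open>Moves the problem from digraph records and library walks to vertex and arc sets that can
  be cut and glued at a vertex.\<close>

lemma rooted_oriented_reeb_graph_iff:
  "rooted_oriented_reeb_graph G r \<longleftrightarrow> planted_reeb True (pverts G) (parcs G) r"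
proof
  assume "rooted_oriented_reeb_graph G r"
  then interpret rooted_oriented_reeb_graph G r .
  have sub: "parcs G \<subseteq> pverts G \<times> pverts G" by (auto dest: in_arcsD1 in_arcsD2)
  have "parcs G `` {r} \<noteq> {} \<or> (parcs G)\<inverse> `` {r} \<noteq> {}"
    using degree_root unfolding degree_eq_deg deg_def by (metis add_0 card.empty zero_neq_one)
  then have ex: "\<exists>v. (r, v) \<in> parcs G"
    using root_edge_outgoing by fastforce
  have conn: "\<forall>x\<in>pverts G. \<forall>y\<in>pverts G. (x, y) \<in> (symcl (parcs G))\<^sup>*"
    using underlying_connected unfolding connected_iff_rtrancl by blast
  have saddle: "parcs G `` {x} \<noteq> {} \<and> (parcs G)\<inverse> `` {x} \<noteq> {}"
    if "x \<in> pverts G" "deg (parcs G) x = 3" for x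
  proof -
    have "x \<in> saddles G" using that by (simp add: saddles_def degree_eq_deg)
    from saddle_not_source[OF this] saddle_not_sink[OF this] show ?thesis
      unfolding in_degree_eq out_degree_eq by (metis card.empty not_one_le_zero)
  qed
  show "planted_reeb True (pverts G) (parcs G) r"
    unfolding planted_reeb_def if_True
  proof (intro conjI)
    show "bridged (parcs G)" by (rule bridged_if_acyclic[OF one_direction underlying_acyclic])
    show "deg (parcs G) r = 1" using degree_root by (simp add: degree_eq_deg)
    show "\<forall>x\<in>pverts G. x \<noteq> r \<longrightarrow> deg (parcs G) x = 1 \<or> deg (parcs G) x = 3"
      using degree_other by (simp add: degree_eq_deg)
  qed (use sub conn saddle ex root_in_verts pair_finite_verts in simp_all)
next
  assume A: "planted_reeb True (pverts G) (parcs G) r"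
  then have sub: "parcs G \<subseteq> pverts G \<times> pverts G" and fin: "finite (pverts G)"
    and br: "bridged (parcs G)"
    by (auto simp: planted_reeb_def)
  have finA: "finite (parcs G)" using sub fin by (meson finite_SigmaI finite_subset)
  interpret pair_digraph G
  proof
    show "fst e \<in> pverts G" "snd e \<in> pverts G" if "e \<in> parcs G" for e
      using sub that by auto
    show "fst e \<noteq> snd e" if "e \<in> parcs G" for e
      using bridged_not_refl[OF br] that by (metis prod.collapse)
  qed (use fin finA in simp_all)
  have finI: "finite (parcs G `` {x})" "finite ((parcs G)\<inverse> `` {x})" for x
    using finA by (simp_all add: finite_Image)
  show "rooted_oriented_reeb_graph G r"
  proof
    show "(v, u) \<notin> parcs G" if "(u, v) \<in> parcs G" for u v
      using bridged_one_direction[OF br that] .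
    show "Digraph_Component.connected (with_proj G)"
      using A unfolding connected_iff_rtrancl planted_reeb_def by blast
    show "\<not> (\<exists>p. pre_digraph.cycle (with_proj (mk_symmetric (with_proj G))) p \<and> 3 \<le> length p)"
      using acyclic_if_bridged[OF br] by (metis not_le)
    show "r \<in> pverts G" "degree G r = 1"
      using A by (simp_all add: planted_reeb_def degree_eq_deg)
    show "degree G v = 1 \<or> degree G v = 3" if "v \<in> pverts G" "v \<noteq> r" for v
      using A that by (simp add: planted_reeb_def degree_eq_deg)
    show "1 \<le> in_degree (with_proj G) v" if "v \<in> saddles G" for v
      using A that finI[of v]
      by (simp add: planted_reeb_def saddles_def degree_eq_deg in_degree_eq Suc_le_eq card_gt_0_iff)
    show "1 \<le> out_degree (with_proj G) v" if "v \<in> saddles G" for v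
      using A that finI[of v]
      by (simp add: planted_reeb_def saddles_def degree_eq_deg out_degree_eq Suc_le_eq card_gt_0_iff)
    show "fst e = r" if "e \<in> parcs G" "fst e = r \<or> snd e = r" for e
    proof -
      obtain v where v: "(r, v) \<in> parcs G" using A by (auto simp: planted_reeb_def)
      have "deg (parcs G) r = 1" using A by (simp add: planted_reeb_def)
      from deg_1_neighbour_unique(2)[OF finA this _ _ v, of "fst e"] show ?thesis
        using that v by (cases e) auto
    qed
  qed
qed

section \<open>Codes\<close>

definition root_arc :: "bool \<Rightarrow> 'a \<Rightarrow> 'a \<Rightarrow> 'a \<times> 'a" where
  "root_arc b r v = (if b then (r, v) else (v, r))"

lemma map_prod_root_arc [simp]: "map_prod f f (root_arc b r v) = root_arc b (f r) (f v)"
  by (simp add: root_arc_def)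

text \<open>The multiset lists the branches at the saddle next to the root (it is empty if the root edge
  ends in a leaf). A flag records whether the edge leading into the branch has the same direction,
  outward or inward, as the edge through which the saddle is reached. With such relative flags the
  codes do not change under reversal of all edges, so inward and outward branches have the same
  codes.\<close>

datatype code = Code "(bool \<times> code) multiset"

text \<open>Both branches are rooted at the saddle \<open>v\<close> and share nothing else. The
  condition \<open>b1 = b \<or> b2 = b\<close> says that \<open>v\<close> is neither sink nor
  source: an arc entering \<open>v\<close> from the root needs a branch arc leaving
  \<open>v\<close>, and an arc leaving towards the root needs one entering.\<close>

inductive has_code :: "bool \<Rightarrow> 'a set \<Rightarrow> 'a rel \<Rightarrow> 'a \<Rightarrow> code \<Rightarrow> bool" where
  leaf: "r \<noteq> v \<Longrightarrow> has_code b {r, v} {root_arc b r v} r (Code {#})"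
| saddle: "\<lbrakk>has_code b1 V1 A1 v t1; has_code b2 V2 A2 v t2; b1 = b \<or> b2 = b;
    V1 \<inter> V2 = {v}; r \<notin> V1 \<union> V2\<rbrakk> \<Longrightarrow>
    has_code b (insert r (V1 \<union> V2)) (insert (root_arc b r v) (A1 \<union> A2)) r
      (Code {#(b1 = b, t1), (b2 = b, t2)#})"

text \<open>The index is the number of saddles of a graph with this code. The premise
  \<open>c \<or> d\<close> is the side condition of \<open>has_code\<close> in terms of relative
  flags.\<close>

inductive valid_code :: "nat \<Rightarrow> code \<Rightarrow> bool" where
  "valid_code 0 (Code {#})"
| "valid_code i s \<Longrightarrow> valid_code j t \<Longrightarrow> c \<or> d \<Longrightarrow> valid_code (Suc (i + j)) (Code {#(c, s), (d, t)#})"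

lemma valid_code_unique: "valid_code i t \<Longrightarrow> valid_code j t \<Longrightarrow> i = j"
proof (induction arbitrary: j rule: valid_code.induct)
  case 1
  then show ?case by cases auto
next
  case (2 i s k t c d)
  note IH = "2.IH"
  from "2.prems" show ?case
  proof cases
    case (2 i' s' k' t' c' d')
    then have "s = s' \<and> t = t' \<or> s = t' \<and> t = s'"
      by (auto simp: add_eq_conv_ex add_mset_eq_singleton_iff)
    then show ?thesis using IH 2 by fastforce
  qed simp
qed

lemma code_pair_eqE:
  assumes "{#p, q#} = {#p', q'#}"
  obtains "p = p'" "q = q'" | "p = q'" "q = p'"
  using assms by (auto simp: add_eq_conv_ex add_mset_eq_singleton_iff)

lemma has_code_wf:
  assumes "has_code b V A r t"
  shows "finite V" "A \<subseteq> V \<times> V" "r \<in> V"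
  using assms by (induction rule: has_code.induct) (auto simp: root_arc_def)

lemma has_code_root_edge:
  assumes "has_code b V A r t"
  obtains v where "v \<in> V" "v \<noteq> r" "A `` {r} = (if b then {v} else {})" "A\<inverse> `` {r} = (if b then {} else {v})"
  using assms
proof cases
  case (leaf v)
  then show ?thesis by (intro that[of v]) (auto simp: root_arc_def)
next
  case (saddle b1 V1 A1 v t1 b2 V2 A2 t2)
  note wf = has_code_wf(2)[OF saddle(4)] has_code_wf(2)[OF saddle(5)] has_code_wf(3)[OF saddle(4)]
  have "r \<noteq> v" "(r, x) \<notin> A1 \<union> A2" "(x, r) \<notin> A1 \<union> A2" for x
    using wf saddle(8) by auto
  then show ?thesis
    using wf(3) by (intro that[of v]) (auto simp: saddle(1,2) root_arc_def Image_iff)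
qed

section \<open>Transport of codes and isomorphisms\<close>

definition planted_iso :: "('a \<Rightarrow> 'b) \<Rightarrow> 'a set \<Rightarrow> 'a rel \<Rightarrow> 'a \<Rightarrow> 'b set \<Rightarrow> 'b rel \<Rightarrow> 'b \<Rightarrow> bool" where
  "planted_iso \<phi> V A r V' A' r' \<longleftrightarrow>
    bij_betw \<phi> V V' \<and> A' = map_prod \<phi> \<phi> ` A \<and> \<phi> r = r'"

text \<open>Both maps send \<open>v\<close> to \<open>v'\<close>, so they agree on the only common
  vertex and can be glued. The union is injective because the images meet only in
  \<open>v'\<close>.\<close>

lemma planted_iso_join:
  assumes iso: "planted_iso \<phi>1 V1 A1 v V1' A1' v'" "planted_iso \<phi>2 V2 A2 v V2' A2' v'"
    and int: "V1 \<inter> V2 = {v}" "V1' \<inter> V2' = {v'}"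
    and r: "r \<notin> V1 \<union> V2" "r' \<notin> V1' \<union> V2'"
    and sub: "A1 \<subseteq> V1 \<times> V1" "A2 \<subseteq> V2 \<times> V2"
  shows "\<exists>\<phi>. planted_iso \<phi>
    (insert r (V1 \<union> V2)) (insert (root_arc b r v) (A1 \<union> A2)) r
    (insert r' (V1' \<union> V2')) (insert (root_arc b r' v') (A1' \<union> A2')) r'"
proof -
  define \<phi> where "\<phi> x = (if x = r then r' else if x \<in> V1 then \<phi>1 x else \<phi>2 x)" for x
  have \<phi>v: "\<phi>1 v = v'" "\<phi>2 v = v'" and v: "v \<in> V1" "v \<in> V2"
    using iso int by (auto simp: planted_iso_def)
  have e1: "\<phi> x = \<phi>1 x" if "x \<in> V1" for x using that r by (auto simp: \<phi>_def)
  have e2: "\<phi> x = \<phi>2 x" if "x \<in> V2" for x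
  proof (cases "x \<in> V1")
    case True
    then have "x = v" using that int by blast
    then show ?thesis using e1[OF True] \<phi>v by simp
  qed (use that r in \<open>auto simp: \<phi>_def\<close>)
  have er: "\<phi> r = r'" by (simp add: \<phi>_def)
  have "\<phi> ` V1 = V1'" "\<phi> ` V2 = V2'"
    using iso e1 e2 image_cong[of V1 V1 \<phi> \<phi>1] image_cong[of V2 V2 \<phi> \<phi>2]
    by (auto simp: planted_iso_def bij_betw_def)
  then have img: "\<phi> ` insert r (V1 \<union> V2) = insert r' (V1' \<union> V2')"
    using er by (simp add: image_Un)
  have inj1: "inj_on \<phi>1 V1" and inj2: "inj_on \<phi>2 V2"
    and im1: "\<phi>1 ` V1 = V1'" and im2: "\<phi>2 ` V2 = V2'"
    using iso by (auto simp: planted_iso_def bij_betw_def)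
  have cross: "x = y" if "x \<in> V1" "y \<in> V2" "\<phi> x = \<phi> y" for x y
  proof -
    have "\<phi>1 x = \<phi>2 y" using that e1 e2 by simp
    then have "\<phi>1 x \<in> V1' \<inter> V2'" using that im1 im2 by (metis IntI imageI)
    then have "\<phi>1 x = v'" "\<phi>2 y = v'" using int \<open>\<phi>1 x = \<phi>2 y\<close> by auto
    then have "x = v" "y = v" using that \<phi>v v inj_onD[OF inj1, of x v] inj_onD[OF inj2, of y v] by auto
    then show ?thesis by simp
  qed
  have "inj_on \<phi> V1" "inj_on \<phi> V2"
    using inj1 inj2 e1 e2 by (auto simp: inj_on_def)
  then have "inj_on \<phi> (V1 \<union> V2)"
    using cross unfolding inj_on_def by (metis Un_iff)
  moreover have "r' \<notin> \<phi> ` (V1 \<union> V2)"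
    using r \<open>\<phi> ` V1 = V1'\<close> \<open>\<phi> ` V2 = V2'\<close> by (simp add: image_Un)
  ultimately have "inj_on \<phi> (insert r (V1 \<union> V2))"
    using er by (auto simp: inj_on_insert)
  moreover have "map_prod \<phi> \<phi> ` A1 = A1'" "map_prod \<phi> \<phi> ` A2 = A2'"
  proof -
    have "map_prod \<phi> \<phi> ` A1 = map_prod \<phi>1 \<phi>1 ` A1"
      using sub e1 by (intro image_cong) auto
    then show "map_prod \<phi> \<phi> ` A1 = A1'" using iso by (simp add: planted_iso_def)
    have "map_prod \<phi> \<phi> ` A2 = map_prod \<phi>2 \<phi>2 ` A2"
      using sub e2 by (intro image_cong) auto
    then show "map_prod \<phi> \<phi> ` A2 = A2'" using iso by (simp add: planted_iso_def)
  qed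
  ultimately have "planted_iso \<phi>
    (insert r (V1 \<union> V2)) (insert (root_arc b r v) (A1 \<union> A2)) r
    (insert r' (V1' \<union> V2')) (insert (root_arc b r' v') (A1' \<union> A2')) r'"
    using img er e1[OF v(1)] \<phi>v unfolding planted_iso_def bij_betw_def
    by (simp add: image_Un)
  then show ?thesis by blast
qed

text \<open>Equal multisets of two branches match either in the given order or crosswise. In both
  cases the isomorphisms of matching branches are glued at the saddle.\<close>

lemma has_code_same_code_iso:
  assumes "has_code b V A r t" "has_code b V' A' r' t"
  shows "\<exists>\<phi>. planted_iso \<phi> V A r V' A' r'"
  using assms
proof (induction arbitrary: V' A' r' rule: has_code.induct)
  case (leaf r v b)
  from leaf(2) obtain v' where *: "r' \<noteq> v'" "V' = {r', v'}" "A' = {root_arc b r' v'}"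
    by cases auto
  show ?case
    unfolding planted_iso_def bij_betw_def
    by (rule exI[of _ "\<lambda>x. if x = r then r' else v'"]) (use * leaf(1) in \<open>auto simp: inj_on_def\<close>)
next
  case (saddle b1 V1 A1 v t1 b2 V2 A2 t2 b r)
  note sub = has_code_wf(2)[OF saddle.hyps(1)] has_code_wf(2)[OF saddle.hyps(2)]
  from saddle.prems show ?case
  proof cases
    case leaf
    then show ?thesis by simp
  next
    case (saddle b1' V1' A1' v' t1' b2' V2' A2' t2')
    note S = saddle
    from S(3) show ?thesis
    proof (cases rule: code_pair_eqE)
      case 1
      \<comment> \<open>The two root arcs have the same direction \<open>b\<close>, so equal
        relative flags mean equal absolute directions.\<close>
      then have "b1' = b1" "b2' = b2" by auto
      then have "has_code b1 V1' A1' v' t1" "has_code b2 V2' A2' v' t2" using 1 S(4,5) by auto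
      then obtain \<phi>1 \<phi>2 where "planted_iso \<phi>1 V1 A1 v V1' A1' v'"
          "planted_iso \<phi>2 V2 A2 v V2' A2' v'"
        using saddle.IH by blast
      from planted_iso_join[OF this _ _ _ _ sub] show ?thesis
        using saddle.hyps S by simp
    next
      case 2
      then have "b2' = b1" "b1' = b2" by auto
      then have "has_code b1 V2' A2' v' t1" "has_code b2 V1' A1' v' t2" using 2 S(4,5) by auto
      then obtain \<phi>1 \<phi>2 where "planted_iso \<phi>1 V1 A1 v V2' A2' v'"
          "planted_iso \<phi>2 V2 A2 v V1' A1' v'"
        using saddle.IH by blast
      from planted_iso_join[OF this _ _ _ _ sub] show ?thesis
        using saddle.hyps S by (simp add: Un_commute Int_commute)
    qed
  qed
qed

lemma has_code_image:
  assumes "has_code b V A r t" "inj_on \<phi> V"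
  shows "has_code b (\<phi> ` V) (map_prod \<phi> \<phi> ` A) (\<phi> r) t"
  using assms
proof (induction rule: has_code.induct)
  case (leaf r v b)
  then have "\<phi> r \<noteq> \<phi> v" by (auto simp: inj_on_def)
  then show ?case using has_code.leaf[of "\<phi> r" "\<phi> v" b] by simp
next
  case (saddle b1 V1 A1 v t1 b2 V2 A2 t2 b r)
  have inj: "inj_on \<phi> V1" "inj_on \<phi> V2"
    using saddle.prems by (auto intro: inj_on_subset)
  have "\<phi> ` V1 \<inter> \<phi> ` V2 = {\<phi> v}"
    using inj_on_image_Int[OF saddle.prems, of V1 V2] saddle.hyps by auto
  moreover have "\<phi> r \<notin> \<phi> ` V1 \<union> \<phi> ` V2"
    using saddle.prems saddle.hyps(5) by (auto simp: inj_on_def)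
  ultimately have "has_code b (insert (\<phi> r) (\<phi> ` V1 \<union> \<phi> ` V2))
      (insert (root_arc b (\<phi> r) (\<phi> v)) (map_prod \<phi> \<phi> ` A1 \<union> map_prod \<phi> \<phi> ` A2)) (\<phi> r)
      (Code {#(b1 = b, t1), (b2 = b, t2)#})"
    using has_code.saddle[OF saddle.IH(1)[OF inj(1)] saddle.IH(2)[OF inj(2)]] saddle.hyps(3) by blast
  then show ?case by (simp add: image_Un)
qed

lemma has_code_exists:
  assumes "valid_code k t"
  shows "\<exists>V A (r::nat). has_code b V A r t"
  using assms
proof (induction arbitrary: b rule: valid_code.induct)
  case 1
  show ?case using has_code.leaf[of "0::nat" 1 b] by (meson zero_neq_one)
next
  case (2 i s j t c d)
  \<comment> \<open>The direction \<open>c = b\<close> is the absolute one belonging to the relative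
    flag \<open>c\<close>, since \<open>(c = b) = b\<close> is \<open>c\<close> again.\<close>
  obtain V1 A1 r1 V2 A2 r2 where R: "has_code (c = b) V1 A1 (r1::nat) s" "has_code (d = b) V2 A2 (r2::nat) t"
    using 2 by metis
  \<comment> \<open>Both branch roots become 0, the other vertices become even numbers from 2 on or
    odd numbers from 3 on, and 1 stays free for the new root.\<close>
  let ?f1 = "\<lambda>x. if x = r1 then 0 else 2 * x + 2" and ?f2 = "\<lambda>x. if x = r2 then 0 else 2 * x + 3"
  have "inj ?f1" "inj ?f2" by (auto simp: inj_def)
  then have I: "has_code (c = b) (?f1 ` V1) (map_prod ?f1 ?f1 ` A1) 0 s"
      "has_code (d = b) (?f2 ` V2) (map_prod ?f2 ?f2 ` A2) 0 t"
    using has_code_image[OF R(1), of ?f1] has_code_image[OF R(2), of ?f2] inj_on_subset by (simp_all, blast+)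
  have int: "?f1 ` V1 \<inter> ?f2 ` V2 = {0}"
    using has_code_wf(3)[OF R(1)] has_code_wf(3)[OF R(2)] by (auto simp: image_iff) presburger+
  have notin: "1 \<notin> ?f1 ` V1 \<union> ?f2 ` V2"
    by (auto simp: image_iff)
  have flags: "((c = b) = b) = c" "((d = b) = b) = d" by auto
  have "(c = b) = b \<or> (d = b) = b"
    using 2(3) by auto
  from has_code.saddle[OF I this int notin] show ?case
    unfolding flags by (intro exI)
qed

text \<open>Reads off the code from the neighbourhoods in the whole graph, without choosing vertex sets for
  the two branches. In contrast to the rules for \<open>has_code\<close> it is evidently deterministic.\<close>

inductive branch :: "'a rel \<Rightarrow> 'a \<Rightarrow> 'a \<Rightarrow> code \<Rightarrow> bool" for A where
  branchI: "(\<And>w. w \<in> symcl A `` {v} - {u} \<Longrightarrow> branch A v w (f w)) \<Longrightarrow>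
   branch A u v (Code (image_mset (\<lambda>w. (((v, w) \<in> A) = ((u, v) \<in> A), f w)) (mset_set (symcl A `` {v} - {u}))))"

lemma branch_deterministic: "branch A u v s \<Longrightarrow> branch A u v t \<Longrightarrow> s = t"
proof (induction arbitrary: t rule: branch.induct)
  case (branchI v u f)
  note IH = branchI.IH
  from branchI.prems show ?case
  proof cases
    case (branchI g)
    note g = branchI
    have "f w = g w" if "w \<in># mset_set (symcl A `` {v} - {u})" for w
    proof -
      \<comment> \<open>An infinite neighbourhood would make \<open>mset_set\<close> empty, leaving
        no \<open>w\<close> to consider.\<close>
      have "w \<in> symcl A `` {v} - {u}"
        using that by (cases "finite (symcl A `` {v} - {u})") (auto simp del: Image_singleton_iff)
      then show ?thesis using IH g(2) by blast
    qed
    then show ?thesis unfolding g(1) by (auto intro: image_mset_cong)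
  qed
qed

section \<open>Gluing at a vertex: coded graphs are planted Reeb graphs\<close>

lemma bridged_singleton: "x \<noteq> y \<Longrightarrow> bridged {(x, y)}"
  by (simp add: bridged_def symcl_def)

lemma bridged_Un:
  assumes br: "bridged A1" "bridged A2"
    and sub: "A1 \<subseteq> V1 \<times> V1" "A2 \<subseteq> V2 \<times> V2" and int: "V1 \<inter> V2 = {v}"
  shows "bridged (A1 \<union> A2)"
proof -
  \<comment> \<open>Collapsing the other part to the common vertex turns a detour into a detour inside one part.\<close>
  have retract: "(x, if z \<in> V1 then z else v) \<in> (symcl (A1 - {e}))\<^sup>*"
    if "(x, z) \<in> (symcl (A1 \<union> A2 - {e}))\<^sup>*" "x \<in> V1"
      "A1 \<subseteq> V1 \<times> V1" "A2 \<subseteq> V2 \<times> V2" "V1 \<inter> V2 = {v}" for x z e A1 A2 and V1 V2 :: "'a set"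
    using that
  proof (induction rule: rtrancl_induct)
    case base
    then show ?case by simp
  next
    case (step y z)
    let ?f = "\<lambda>z. if z \<in> V1 then z else v"
    consider "(y, z) \<in> symcl (A1 - {e})" | "(y, z) \<in> symcl A2"
      using step.hyps(2) by (auto simp: symcl_iff)
    then show ?case
    proof cases
      case 1
      then have "y \<in> V1" "z \<in> V1" using step.prems by (auto simp: symcl_iff)
      then show ?thesis using step.IH[OF step.prems] 1 by (simp add: rtrancl.rtrancl_into_rtrancl)
    next
      case 2
      then have "y \<in> V2" "z \<in> V2" using step.prems by (auto simp: symcl_iff)
      then have "?f y = v" "?f z = v" using step.prems(4) by auto
      then show ?thesis using step.IH[OF step.prems] by argo
    qed
  qed
  show ?thesis
    unfolding bridged_def
  proof (intro allI impI notI)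
    fix x y assume xy: "(x, y) \<in> A1 \<union> A2" and conn: "(x, y) \<in> (symcl (A1 \<union> A2 - {(x, y)}))\<^sup>*"
    then consider "(x, y) \<in> A1" | "(x, y) \<in> A2" by auto
    then show False
    proof cases
      case 1
      then have "x \<in> V1" "y \<in> V1" using sub by auto
      then show ?thesis
        using retract[OF conn _ sub int] br(1) 1 by (auto simp: bridged_def)
    next
      case 2
      then have "x \<in> V2" "y \<in> V2" using sub by auto
      then show ?thesis
        using retract[OF conn[unfolded Un_commute[of A1]] _ sub(2,1)] int br(2) 2
        by (auto simp: bridged_def Int_commute)
    qed
  qed
qed

lemma connected_Un:
  assumes "\<forall>x\<in>V1. \<forall>y\<in>V1. (x, y) \<in> (symcl A1)\<^sup>*" "\<forall>x\<in>V2. \<forall>y\<in>V2. (x, y) \<in> (symcl A2)\<^sup>*"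
    and "v \<in> V1" "v \<in> V2"
  shows "\<forall>x\<in>V1 \<union> V2. \<forall>y\<in>V1 \<union> V2. (x, y) \<in> (symcl (A1 \<union> A2))\<^sup>*"
proof -
  have sub: "(symcl A1)\<^sup>* \<subseteq> (symcl (A1 \<union> A2))\<^sup>*" "(symcl A2)\<^sup>* \<subseteq> (symcl (A1 \<union> A2))\<^sup>*"
    by (auto intro!: rtrancl_mono symcl_mono)
  have "(x, v) \<in> (symcl (A1 \<union> A2))\<^sup>*" "(v, x) \<in> (symcl (A1 \<union> A2))\<^sup>*" if "x \<in> V1 \<union> V2" for x
    using that assms sub by blast+
  then show ?thesis by (meson rtrancl_trans)
qed

text \<open>Reduces degrees and source or sink conditions of the joined graph to those of its
  branches: only at \<open>v\<close> do the three pieces interact.\<close>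

lemma saddle_Image:
  fixes A1 A2 :: "'a rel" and b :: bool
  assumes "has_code b1 V1 A1 v t1" "has_code b2 V2 A2 v t2" "V1 \<inter> V2 = {v}" "r \<notin> V1 \<union> V2"
  defines "A \<equiv> insert (root_arc b r v) (A1 \<union> A2)"
  shows "x \<in> V1 - {v} \<Longrightarrow> A `` {x} = A1 `` {x} \<and> A\<inverse> `` {x} = A1\<inverse> `` {x}"
    and "x \<in> V2 - {v} \<Longrightarrow> A `` {x} = A2 `` {x} \<and> A\<inverse> `` {x} = A2\<inverse> `` {x}"
    and "A `` {r} = (if b then {v} else {})" "A\<inverse> `` {r} = (if b then {} else {v})"
    and "A `` {v} = (if b then {} else {r}) \<union> A1 `` {v} \<union> A2 `` {v}"
    and "A\<inverse> `` {v} = (if b then {r} else {}) \<union> A1\<inverse> `` {v} \<union> A2\<inverse> `` {v}"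
proof -
  note wf = has_code_wf(2)[OF assms(1)] has_code_wf(2)[OF assms(2)] has_code_wf(3)[OF assms(1)]
  have "r \<noteq> v" using wf(3) assms(4) by auto
  show "A `` {x} = A1 `` {x} \<and> A\<inverse> `` {x} = A1\<inverse> `` {x}" if "x \<in> V1 - {v}"
  proof -
    have "x \<noteq> r" "x \<noteq> v" "x \<notin> V2" using that assms(3,4) by auto
    then have "(x, y) \<notin> A2" "(y, x) \<notin> A2" for y using wf by auto
    then show ?thesis using \<open>x \<noteq> r\<close> \<open>x \<noteq> v\<close> by (auto simp: A_def root_arc_def)
  qed
  show "A `` {x} = A2 `` {x} \<and> A\<inverse> `` {x} = A2\<inverse> `` {x}" if "x \<in> V2 - {v}"
  proof -
    have "x \<noteq> r" "x \<noteq> v" "x \<notin> V1" using that assms(3,4) by auto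
    then have "(x, y) \<notin> A1" "(y, x) \<notin> A1" for y using wf by auto
    then show ?thesis using \<open>x \<noteq> r\<close> \<open>x \<noteq> v\<close> by (auto simp: A_def root_arc_def)
  qed
  have "(r, y) \<notin> A1 \<union> A2" "(y, r) \<notin> A1 \<union> A2" for y using wf assms(4) by auto
  then show "A `` {r} = (if b then {v} else {})" "A\<inverse> `` {r} = (if b then {} else {v})"
    using \<open>r \<noteq> v\<close> by (auto simp: A_def root_arc_def)
  show "A `` {v} = (if b then {} else {r}) \<union> A1 `` {v} \<union> A2 `` {v}"
    "A\<inverse> `` {v} = (if b then {r} else {}) \<union> A1\<inverse> `` {v} \<union> A2\<inverse> `` {v}"
    using \<open>r \<noteq> v\<close> by (auto simp: A_def root_arc_def)
qed

lemma has_code_imp_planted_reeb: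
  assumes "has_code b V A r t"
  shows "planted_reeb b V A r \<and> valid_code (card {x \<in> V. deg A x = 3}) t"
  using assms
proof (induction rule: has_code.induct)
  case (leaf r v b)
  have arc: "{root_arc b r v} `` {r} = (if b then {v} else {})" "{root_arc b r v}\<inverse> `` {r} = (if b then {} else {v})"
    "{root_arc b r v} `` {v} = (if b then {} else {r})" "{root_arc b r v}\<inverse> `` {v} = (if b then {r} else {})"
    using leaf by (auto simp: root_arc_def)
  then have deg: "deg {root_arc b r v} r = 1" "deg {root_arc b r v} v = 1"
    unfolding deg_def by simp_all
  have "(r, v) \<in> symcl {root_arc b r v}" "(v, r) \<in> symcl {root_arc b r v}"
    by (auto simp: symcl_iff root_arc_def)
  then have conn: "\<forall>x\<in>{r, v}. \<forall>y\<in>{r, v}. (x, y) \<in> (symcl {root_arc b r v})\<^sup>*"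
    by blast
  have br: "bridged {root_arc b r v}"
    using leaf by (auto simp: root_arc_def bridged_singleton)
  have "{x \<in> {r, v}. deg {root_arc b r v} x = 3} = {}"
    using deg by auto
  then have "valid_code (card {x \<in> {r, v}. deg {root_arc b r v} x = 3}) (Code {#})"
    by (simp only: card.empty valid_code.intros(1))
  moreover have "{root_arc b r v} \<subseteq> {r, v} \<times> {r, v}"
    by (simp add: root_arc_def)
  moreover have "\<exists>u. (if b then (r, u) else (u, r)) \<in> {root_arc b r v}"
    by (auto simp: root_arc_def)
  ultimately show ?case
    unfolding planted_reeb_def using deg conn br by (auto simp del: insert_iff)
next
  case (saddle b1 V1 A1 v t1 b2 V2 A2 t2 b r)
  define A where "A = insert (root_arc b r v) (A1 \<union> A2)"
  define V where "V = insert r (V1 \<union> V2)"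
  note D = saddle_Image[OF saddle.hyps(1,2,4,5), where b = b, folded A_def]
  note wf1 = has_code_wf[OF saddle.hyps(1)] and wf2 = has_code_wf[OF saddle.hyps(2)]
  note P1 = saddle.IH(1)[THEN conjunct1, unfolded planted_reeb_def]
  note P2 = saddle.IH(2)[THEN conjunct1, unfolded planted_reeb_def]
  have rv: "r \<noteq> v" using wf1 saddle.hyps(5) by auto
  obtain w1 where w1: "w1 \<in> V1" "w1 \<noteq> v" "A1 `` {v} = (if b1 then {w1} else {})"
    "A1\<inverse> `` {v} = (if b1 then {} else {w1})" by (rule has_code_root_edge[OF saddle.hyps(1)])
  obtain w2 where w2: "w2 \<in> V2" "w2 \<noteq> v" "A2 `` {v} = (if b2 then {w2} else {})"
    "A2\<inverse> `` {v} = (if b2 then {} else {w2})" by (rule has_code_root_edge[OF saddle.hyps(2)])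
  have ne: "w1 \<noteq> w2" "r \<noteq> w1" "r \<noteq> w2"
    using w1 w2 saddle.hyps(4,5) by auto
  have deg1: "deg A x = deg A1 x" if "x \<in> V1 - {v}" for x
    using D(1)[OF that] by (simp add: deg_def)
  have deg2: "deg A x = deg A2 x" if "x \<in> V2 - {v}" for x
    using D(2)[OF that] by (simp add: deg_def)
  have degr: "deg A r = 1" unfolding deg_def D by simp
  have degv: "deg A v = 3" unfolding deg_def D w1 w2 using ne saddle.hyps(3) by auto
  have saddlev: "A `` {v} \<noteq> {}" "A\<inverse> `` {v} \<noteq> {}"
    unfolding D w1 w2 using saddle.hyps(3) by auto
  have rest: "x = r \<or> x = v \<or> x \<in> V1 - {v} \<or> x \<in> V2 - {v}" if "x \<in> V" for x
    using that by (auto simp: V_def)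
  \<comment> \<open>The root arc is treated as a third graph on \<open>{r, v}\<close> that meets the
    branches only in \<open>v\<close>, so the gluing lemmas apply once more.\<close>
  have split: "insert r (V1 \<union> V2) = {r, v} \<union> (V1 \<union> V2)"
    "insert (root_arc b r v) (A1 \<union> A2) = {root_arc b r v} \<union> (A1 \<union> A2)"
    using wf1 by auto
  have "planted_reeb b V A r"
    unfolding planted_reeb_def
  proof (intro conjI)
    show "finite V" using wf1 wf2 by (simp add: V_def)
    show "A \<subseteq> V \<times> V" using wf1 wf2 by (auto simp: A_def V_def root_arc_def)
    have b0: "bridged {root_arc b r v}"
      using rv by (auto simp: root_arc_def bridged_singleton)
    have b12: "bridged (A1 \<union> A2)"
      using bridged_Un[OF _ _ wf1(2) wf2(2) saddle.hyps(4)] P1 P2 by blast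
    show "bridged A"
      unfolding A_def split(2)
      by (rule bridged_Un[OF b0 b12, of "{r, v}" "V1 \<union> V2" v])
        (use wf1 wf2 saddle.hyps(5) in \<open>auto simp: root_arc_def\<close>)
    have c0: "\<forall>x\<in>{r, v}. \<forall>y\<in>{r, v}. (x, y) \<in> (symcl {root_arc b r v})\<^sup>*"
      by (auto simp: symcl_iff root_arc_def)
    have c12: "\<forall>x\<in>V1 \<union> V2. \<forall>y\<in>V1 \<union> V2. (x, y) \<in> (symcl (A1 \<union> A2))\<^sup>*"
      by (rule connected_Un[of _ _ _ _ v]) (use P1 P2 in blast)+
    show "\<forall>x\<in>V. \<forall>y\<in>V. (x, y) \<in> (symcl A)\<^sup>*"
      unfolding A_def V_def split by (rule connected_Un[OF c0 c12, of v]) (use wf1 in auto)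
    show "r \<in> V" by (simp add: V_def)
    show "deg A r = 1" by (fact degr)
    show "\<forall>x\<in>V. x \<noteq> r \<longrightarrow> deg A x = 1 \<or> deg A x = 3"
    proof (intro ballI impI)
      fix x assume "x \<in> V" "x \<noteq> r"
      with rest consider "x = v" | "x \<in> V1 - {v}" | "x \<in> V2 - {v}" by blast
      then show "deg A x = 1 \<or> deg A x = 3"
      proof cases
        case 1 then show ?thesis using degv by simp
      next
        case 2 then show ?thesis unfolding deg1[OF 2] using P1 by blast
      next
        case 3 then show ?thesis unfolding deg2[OF 3] using P2 by blast
      qed
    qed
    show "\<forall>x\<in>V. deg A x = 3 \<longrightarrow> A `` {x} \<noteq> {} \<and> A\<inverse> `` {x} \<noteq> {}"
    proof (intro ballI impI)
      fix x assume x: "x \<in> V" "deg A x = 3"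
      then have "x \<noteq> r" using degr by auto
      with rest x consider "x = v" | "x \<in> V1 - {v}" | "x \<in> V2 - {v}" by blast
      then show "A `` {x} \<noteq> {} \<and> A\<inverse> `` {x} \<noteq> {}"
      proof cases
        case 1 then show ?thesis using saddlev by simp
      next
        case 2
        then have "deg A1 x = 3" using deg1 x by simp
        then show ?thesis using D(1)[OF 2] P1 2 by (metis DiffD1)
      next
        case 3
        then have "deg A2 x = 3" using deg2 x by simp
        then show ?thesis using D(2)[OF 3] P2 3 by (metis DiffD1)
      qed
    qed
    show "\<exists>v. (if b then (r, v) else (v, r)) \<in> A"
      by (rule exI[of _ v]) (simp add: A_def root_arc_def)
  qed
  moreover have "valid_code (card {x \<in> V. deg A x = 3}) (Code {#(b1 = b, t1), (b2 = b, t2)#})"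
  proof -
    let ?S1 = "{x \<in> V1. deg A1 x = 3}" and ?S2 = "{x \<in> V2. deg A2 x = 3}"
    \<comment> \<open>As the root of each branch, \<open>v\<close> has degree 1 there and is counted
      in neither branch. It is the one new saddle, which yields the \<open>Suc\<close>.\<close>
    have "deg A1 v = 1" "deg A2 v = 1" using P1 P2 by blast+
    then have v: "v \<notin> ?S1" "v \<notin> ?S2" by auto
    have "{x \<in> V. deg A x = 3} = insert v (?S1 \<union> ?S2)"
    proof (intro set_eqI iffI)
      fix x assume x: "x \<in> {x \<in> V. deg A x = 3}"
      then have "x \<noteq> r" using degr by auto
      with rest x consider "x = v" | "x \<in> V1 - {v}" | "x \<in> V2 - {v}" by blast
      then show "x \<in> insert v (?S1 \<union> ?S2)"
        by cases (use x deg1 deg2 in auto)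
    next
      fix x assume "x \<in> insert v (?S1 \<union> ?S2)"
      then consider "x = v" | "x \<in> V1 - {v}" "deg A1 x = 3" | "x \<in> V2 - {v}" "deg A2 x = 3"
        using v by blast
      then show "x \<in> {x \<in> V. deg A x = 3}"
        by cases (use wf1 degv deg1 deg2 in \<open>auto simp: V_def\<close>)
    qed
    moreover have "?S1 \<inter> ?S2 = {}"
    proof -
      have "?S1 \<inter> ?S2 \<subseteq> V1 \<inter> V2" by blast
      then show ?thesis using v unfolding saddle.hyps(4) by blast
    qed
    ultimately have card: "card {x \<in> V. deg A x = 3} = Suc (card ?S1 + card ?S2)"
      using v wf1(1) wf2(1) by (simp add: card_Un_disjoint)
    show ?thesis
      unfolding card
      by (rule valid_code.intros(2)) (use saddle.IH saddle.hyps(3) in auto)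
  qed
  ultimately show ?case unfolding A_def V_def by blast
qed

section \<open>Uniqueness and existence of the code of a graph\<close>

text \<open>Here \<open>B\<close> is the whole graph and \<open>A\<close> a part attached to the
  rest only at its root \<open>r\<close>: every other vertex of the part has all its neighbours
  inside. This generality lets the induction pass to branches while \<open>branch\<close> keeps
  reading the whole graph.\<close>

lemma has_code_imp_branch:
  assumes "has_code b V A r t" "A \<subseteq> B" "bridged B"
    and "\<And>x. x \<in> V - {r} \<Longrightarrow> symcl B `` {x} = symcl A `` {x}"
  shows "\<exists>v. symcl A `` {r} = {v} \<and> ((r, v) \<in> B) = b \<and> branch B r v t"
  using assms
proof (induction rule: has_code.induct)
  case (leaf r v b)
  have "symcl {root_arc b r v} `` {r} = {v}" "symcl {root_arc b r v} `` {v} = {r}"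
    using leaf(1) by (auto simp: root_arc_def symcl_iff)
  moreover have "((r, v) \<in> B) = b"
    using leaf bridged_one_direction[OF leaf(3), of v r] by (auto simp: root_arc_def split: if_splits)
  moreover have "branch B r v (Code {#})"
    using branchI[of B v r "\<lambda>_. Code {#}"] leaf(4)[of v] leaf(1) calculation(2) by simp
  ultimately show ?case by blast
next
  case (saddle b1 V1 A1 v t1 b2 V2 A2 t2 b r)
  define A where "A = insert (root_arc b r v) (A1 \<union> A2)"
  note D = saddle_Image[OF saddle.hyps(1,2,4,5), where b = b, folded A_def]
  note wf1 = has_code_wf[OF saddle.hyps(1)] and wf2 = has_code_wf[OF saddle.hyps(2)]
  have sub: "A1 \<subseteq> B" "A2 \<subseteq> B" using saddle.prems(1) by auto
  have out: "symcl B `` {x} = symcl A `` {x}" if "x \<in> V1 \<union> V2" for x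
    using saddle.prems(3)[of x] that saddle.hyps(5) by (auto simp: A_def)
  have out1: "symcl B `` {x} = symcl A1 `` {x}" if "x \<in> V1 - {v}" for x
    using out[of x] D(1)[OF that] that by (simp add: symcl_Image)
  have out2: "symcl B `` {x} = symcl A2 `` {x}" if "x \<in> V2 - {v}" for x
    using out[of x] D(2)[OF that] that by (simp add: symcl_Image)
  obtain w1 where w1: "symcl A1 `` {v} = {w1}" "((v, w1) \<in> B) = b1" "branch B v w1 t1"
    using saddle.IH(1)[OF sub(1) saddle.prems(2) out1] by blast
  obtain w2 where w2: "symcl A2 `` {v} = {w2}" "((v, w2) \<in> B) = b2" "branch B v w2 t2"
    using saddle.IH(2)[OF sub(2) saddle.prems(2) out2] by blast
  have "(v, w1) \<in> symcl A1" "(v, w2) \<in> symcl A2" using w1 w2 by auto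
  then have in12: "w1 \<in> V1" "w2 \<in> V2" "(v, w1) \<in> symcl B" "(v, w2) \<in> symcl B"
    using wf1(2) wf2(2) sub by (auto simp: symcl_iff)
  have "(v, v) \<notin> symcl B" using bridged_not_refl[OF saddle.prems(2)] by (auto simp: symcl_iff)
  then have "w1 \<noteq> v" "w2 \<noteq> v" using in12 by auto
  then have ne: "w1 \<noteq> w2" "r \<noteq> w1" "r \<noteq> w2"
    using in12 saddle.hyps(4,5) by auto
  have nbv: "symcl B `` {v} - {r} = {w1, w2}"
    using out[of v] wf1(3) D(5,6) w1(1) w2(1) ne unfolding symcl_Image by auto
  have nbr: "symcl A `` {r} = {v}" unfolding symcl_Image D by simp
  have dir: "((r, v) \<in> B) = b"
    using saddle.prems(1) bridged_one_direction[OF saddle.prems(2), of v r]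
    by (auto simp: root_arc_def split: if_splits)
  have "branch B r v (Code (image_mset (\<lambda>w. (((v, w) \<in> B) = ((r, v) \<in> B), if w = w1 then t1 else t2))
      (mset_set (symcl B `` {v} - {r}))))"
    by (rule branchI) (use w1 w2 in \<open>auto simp: nbv simp del: Image_singleton_iff\<close>)
  also have "Code (image_mset (\<lambda>w. (((v, w) \<in> B) = ((r, v) \<in> B), if w = w1 then t1 else t2))
      (mset_set (symcl B `` {v} - {r}))) = Code {#(b1 = b, t1), (b2 = b, t2)#}"
    unfolding nbv using ne w1(2) w2(2) dir by simp
  finally show ?case
    using nbr dir by (auto simp: A_def simp del: Image_singleton_iff)
qed

text \<open>However the rules of \<open>has_code\<close> name and split the branches, every
  derivation ends in the code that \<open>branch\<close> reads off from \<open>A\<close>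
  itself.\<close>

lemma has_code_deterministic:
  assumes "has_code b V A r s" "has_code b V A r t"
  shows "s = t"
proof -
  have "bridged A" using has_code_imp_planted_reeb[OF assms(1)] by (simp add: planted_reeb_def)
  from has_code_imp_branch[OF assms(1) order_refl this] has_code_imp_branch[OF assms(2) order_refl this]
  obtain u v where "symcl A `` {r} = {u}" "branch A r u s" "symcl A `` {r} = {v}" "branch A r v t"
    by auto
  then show ?thesis using branch_deterministic by (metis singleton_inject)
qed

lemma rtrancl_closed: "(x, y) \<in> R\<^sup>* \<Longrightarrow> x \<in> X \<Longrightarrow> R `` X \<subseteq> X \<Longrightarrow> y \<in> X"
  by (induction rule: rtrancl_induct) auto

text \<open>Induction on the number of vertices. If the neighbour \<open>v\<close> of the root is a
  saddle, deleting \<open>v\<close> separates its three neighbours. The components of the two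
  neighbours other than \<open>r\<close>, with \<open>v\<close> put back as root, are smaller
  planted Reeb graphs.\<close>

lemma planted_reeb_imp_has_code:
  assumes "planted_reeb b V A r"
  shows "\<exists>t. has_code b V A r t"
  using assms
proof (induction "card V" arbitrary: b V A r rule: less_induct)
  case less
  have finV: "finite V" and sub: "A \<subseteq> V \<times> V" and br: "bridged A"
    and conn: "\<And>x y. x \<in> V \<Longrightarrow> y \<in> V \<Longrightarrow> (x, y) \<in> (symcl A)\<^sup>*"
    and rV: "r \<in> V" and degr: "deg A r = 1"
    and degs: "\<And>x. x \<in> V \<Longrightarrow> x \<noteq> r \<Longrightarrow> deg A x = 1 \<or> deg A x = 3"
    and sad: "\<And>x. x \<in> V \<Longrightarrow> deg A x = 3 \<Longrightarrow> A `` {x} \<noteq> {} \<and> A\<inverse> `` {x} \<noteq> {}"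
    and ex: "\<exists>v. (if b then (r, v) else (v, r)) \<in> A"
    using less.prems unfolding planted_reeb_def by blast+
  have finA: "finite A" using sub finV by (meson finite_SigmaI finite_subset)
  obtain v where arc: "root_arc b r v \<in> A" using ex by (auto simp: root_arc_def)
  have nbr: "x = v" if "(r, x) \<in> symcl A" for x
    using deg_1_neighbour_unique(1)[OF finA degr, of v x] that arc
    by (auto simp: symcl_iff root_arc_def split: if_splits)
  have rv: "(r, v) \<in> symcl A" "(v, r) \<in> symcl A"
    using arc by (auto simp: symcl_iff root_arc_def split: if_splits)
  have symsym: "(y, x) \<in> symcl A" if "(x, y) \<in> symcl A" for x y
    using that by (auto simp: symcl_iff)
  have subs: "symcl A \<subseteq> V \<times> V" using sub by (auto simp: symcl_def)
  have noloop: "(x, x) \<notin> symcl A" for x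
    using bridged_not_refl[OF br] by (auto simp: symcl_iff)
  have vV: "v \<in> V" and "v \<noteq> r" using rv subs noloop by auto
  have arc_eq: "(x, y) = root_arc b r v" if "(x, y) \<in> A" "x = r \<or> y = r" for x y
  proof -
    have "x = r \<and> y = v \<or> x = v \<and> y = r"
      using that nbr[of x] nbr[of y] by (auto simp: symcl_iff)
    then show ?thesis
      using that arc bridged_one_direction[OF br] by (auto simp: root_arc_def split: if_splits)
  qed
  consider "deg A v = 1" | "deg A v = 3" using degs vV \<open>v \<noteq> r\<close> by blast
  then show ?case
  proof cases
    case 1
    note tip = this
    have nbv: "x = r" if "(v, x) \<in> symcl A" for x
      using deg_1_neighbour_unique(1)[OF finA tip, of r x] that rv by (auto simp: symcl_iff)
    \<comment> \<open>A set that contains the root and is closed under adjacency is all of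
      \<open>V\<close> by connectedness.\<close>
    have "symcl A `` {r, v} \<subseteq> {r, v}" using nbr nbv by auto
    then have "V \<subseteq> {r, v}" using rtrancl_closed[OF conn[OF rV], of _ "{r, v}"] by (simp add: subsetI)
    then have V: "V = {r, v}" using rV vV by blast
    have "A \<subseteq> {root_arc b r v}"
    proof
      fix e assume e: "e \<in> A"
      obtain x y where xy: "e = (x, y)" by (cases e)
      then have "x \<in> {r, v}" "y \<in> {r, v}" "x \<noteq> y"
        using e sub V bridged_not_refl[OF br] by auto
      then show "e \<in> {root_arc b r v}" using arc_eq[of x y] e xy by auto
    qed
    then have "A = {root_arc b r v}" using arc by blast
    then show ?thesis unfolding V using has_code.leaf[of r v b] \<open>v \<noteq> r\<close> by metis
  next
    case 2
    note branching = this
    define N where "N = symcl A `` {v}"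
    \<comment> \<open>Without antiparallel arcs, successors and predecessors of \<open>v\<close> are
      disjoint, so the degree counts neighbours.\<close>
    have "A `` {v} \<inter> A\<inverse> `` {v} = {}" using bridged_one_direction[OF br] by auto
    then have "card N = 3"
      using branching finA unfolding N_def symcl_Image deg_def
      by (simp add: card_Un_disjoint finite_Image)
    have N: "x \<in> N \<longleftrightarrow> (v, x) \<in> symcl A" for x by (simp add: N_def)
    have rN: "r \<in> N" using rv by (simp add: N_def)
    then have "card (N - {r}) = 2" using \<open>card N = 3\<close> by simp
    then obtain w1 w2 where w: "N - {r} = {w1, w2}" "w1 \<noteq> w2" by (meson card_2_iff)
    \<comment> \<open>Adjacency after deletion of \<open>v\<close>; its reachability classes are the
      pieces to be coded.\<close>
    define F where "F = {(x, y) \<in> symcl A. x \<noteq> v \<and> y \<noteq> v}"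
    have symF: "sym (F\<^sup>*)" by (rule sym_rtrancl) (auto simp: F_def sym_def symsym)
    \<comment> \<open>A path between two neighbours of \<open>v\<close> that avoids
      \<open>v\<close>, prolonged by the edge from \<open>w\<close> to \<open>v\<close>, would be a
      detour around the edge between \<open>u\<close> and \<open>v\<close>.\<close>
    have sep: "(u, w) \<notin> F\<^sup>*" if uw_in: "u \<in> N" "w \<in> N" "u \<noteq> w" for u w
    proof
      assume uw: "(u, w) \<in> F\<^sup>*"
      obtain e where e: "e \<in> A" "e = (v, u) \<or> e = (u, v)"
        using uw_in(1) N[of u] by (auto simp: symcl_iff)
      have "F \<subseteq> symcl (A - {e})" using e by (auto simp: F_def symcl_iff)
      from rtrancl_mono[OF this] have "(u, w) \<in> (symcl (A - {e}))\<^sup>*" using uw by (rule subsetD)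
      moreover have "(w, v) \<in> symcl (A - {e})"
        using that N e by (auto simp: symcl_iff)
      ultimately have "(u, v) \<in> (symcl (A - {e}))\<^sup>*" by (rule rtrancl_into_rtrancl)
      then show False
        using br e rtrancl_symcl_commute unfolding bridged_def by metis
    qed
    define B where "B w = F\<^sup>* `` {w}" for w
    define U where "U w = insert v (B w)" for w
    define E where "E w = A \<inter> U w \<times> U w" for w
    have vB: "v \<notin> B w" if "w \<in> N" for w
    proof
      assume "v \<in> B w"
      then have "(w, v) \<in> F\<^sup>*" by (simp add: B_def)
      then show False using that N noloop by (cases rule: rtranclE) (auto simp: F_def)
    qed
    have Bstep: "y = v \<or> y \<in> B w" if "x \<in> B w" "(x, y) \<in> symcl A" "w \<in> N" for x y w
    proof (cases "y = v")
      case False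
      moreover have "x \<noteq> v" using that vB by auto
      ultimately have "(x, y) \<in> F" using that by (simp add: F_def)
      then show ?thesis using that by (auto simp: B_def intro: rtrancl_into_rtrancl)
    qed simp
    have BV: "B w \<subseteq> V" if "w \<in> N" for w
    proof
      fix x assume "x \<in> B w"
      then have "(w, x) \<in> F\<^sup>*" by (simp add: B_def)
      then show "x \<in> V"
        by (cases rule: rtranclE) (use that N subs in \<open>auto simp: F_def\<close>)
    qed
    have BN: "u = w" if "u \<in> B w" "u \<in> N" "w \<in> N" for u w
      using that sep[of w u] by (auto simp: B_def)
    have wB: "w \<in> B w" for w by (simp add: B_def)
    have part: "planted_reeb ((v, w) \<in> A) (U w) (E w) v" and small: "card (U w) < card V"
      if w: "w \<in> N - {r}" for w
    proof -
      have wN: "w \<in> N" and wr: "w \<noteq> r" using w by auto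
      \<comment> \<open>The root is another neighbour of \<open>v\<close>, hence lies in another
        component. This makes \<open>U w\<close> a proper subset of \<open>V\<close>.\<close>
      have "r \<notin> U w" using BN[OF _ rN wN] wr \<open>v \<noteq> r\<close> by (auto simp: U_def)
      then have "U w \<subset> V" using BV[OF wN] rV vV by (auto simp: U_def)
      then show "card (U w) < card V" using finV by (simp add: psubset_card_mono)
      have nb: "y = w" if "(v, y) \<in> symcl A" "y \<in> U w" for y
        using that BN[of y w] wN N[of y] noloop[of v] by (auto simp: U_def)
      have dir: "(v, w) \<in> A \<longleftrightarrow> (w, v) \<notin> A"
        using wN bridged_one_direction[OF br] by (auto simp: N symcl_iff)
      have Ev: "E w `` {v} = (if (v, w) \<in> A then {w} else {})"
        "(E w)\<inverse> `` {v} = (if (v, w) \<in> A then {} else {w})"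
        using nb dir wB[of w] by (auto simp: E_def U_def symcl_iff)
      \<comment> \<open>Edges from a component lead into it or to \<open>v\<close>, so restriction
        to \<open>U w\<close> changes neighbourhoods only at \<open>v\<close>.\<close>
      have EB: "E w `` {x} = A `` {x}" "(E w)\<inverse> `` {x} = A\<inverse> `` {x}" if "x \<in> B w" for x
        using Bstep[OF that _ wN] that by (auto simp: E_def U_def symcl_iff)
      have degB: "deg (E w) x = deg A x" if "x \<in> B w" for x
        unfolding deg_def EB[OF that] ..
      have degv: "deg (E w) v = 1" unfolding deg_def Ev by simp
      have vw: "(v, w) \<in> symcl (E w)"
        using wN wB[of w] by (auto simp: N E_def U_def symcl_iff)
      have "(v, x) \<in> (symcl (E w))\<^sup>*" if "(w, x) \<in> F\<^sup>*" for x
        using that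
      proof (induction rule: rtrancl_induct)
        case base
        then show ?case using vw by blast
      next
        case (step y z)
        then have "y \<in> B w" "z \<in> B w" by (auto simp: B_def intro: rtrancl_into_rtrancl)
        then have "(y, z) \<in> symcl (E w)"
          using step.hyps(2) by (auto simp: F_def E_def U_def symcl_iff)
        then show ?case using step.IH by (rule rtrancl_into_rtrancl[rotated])
      qed
      then have "(v, x) \<in> (symcl (E w))\<^sup>*" if "x \<in> U w" for x
        using that by (auto simp: U_def B_def)
      then have connU: "\<forall>x\<in>U w. \<forall>y\<in>U w. (x, y) \<in> (symcl (E w))\<^sup>*"
        by (meson rtrancl_symcl_commute rtrancl_trans)
      show "planted_reeb ((v, w) \<in> A) (U w) (E w) v"
        unfolding planted_reeb_def
      proof (intro conjI)
        show "finite (U w)" using \<open>U w \<subset> V\<close> finV by (meson finite_subset psubset_imp_subset)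
        show "bridged (E w)" using bridged_mono[OF br] by (simp add: E_def)
        show "\<forall>x\<in>U w. x \<noteq> v \<longrightarrow> deg (E w) x = 1 \<or> deg (E w) x = 3"
        proof (intro ballI impI)
          fix x assume "x \<in> U w" "x \<noteq> v"
          then have "x \<in> B w" by (simp add: U_def)
          moreover have "x \<noteq> r" "x \<in> V" using \<open>x \<in> U w\<close> \<open>r \<notin> U w\<close> \<open>U w \<subset> V\<close> by auto
          ultimately show "deg (E w) x = 1 \<or> deg (E w) x = 3" using degB degs by simp
        qed
        show "\<forall>x\<in>U w. deg (E w) x = 3 \<longrightarrow> E w `` {x} \<noteq> {} \<and> (E w)\<inverse> `` {x} \<noteq> {}"
        proof (intro ballI impI)
          fix x assume x: "x \<in> U w" "deg (E w) x = 3"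
          then have "x \<in> B w" using degv by (auto simp: U_def)
          then show "E w `` {x} \<noteq> {} \<and> (E w)\<inverse> `` {x} \<noteq> {}"
            using x(2) sad[of x] BV[OF wN] degB EB by auto
        qed
        show "\<exists>u. (if (v, w) \<in> A then (v, u) else (u, v)) \<in> E w"
          using vw dir by (intro exI[of _ w]) (auto simp: symcl_iff E_def)
      qed (use connU degv in \<open>auto simp: E_def U_def\<close>)
    qed
    have w12: "w1 \<in> N - {r}" "w2 \<in> N - {r}" using w(1) by blast+
    obtain t1 where t1: "has_code ((v, w1) \<in> A) (U w1) (E w1) v t1"
      using less.hyps[OF small part] w12 by blast
    obtain t2 where t2: "has_code ((v, w2) \<in> A) (U w2) (E w2) v t2"
      using less.hyps[OF small part] w12 by blast
    have int: "U w1 \<inter> U w2 = {v}"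
    proof -
      have "x \<notin> B w2" if "x \<in> B w1" for x
      proof
        assume "x \<in> B w2"
        then have "(w1, x) \<in> F\<^sup>*" "(x, w2) \<in> F\<^sup>*"
          using that symF by (auto simp: B_def dest: symD)
        then show False using sep[of w1 w2] w12 w(2) rtrancl_trans[of w1 x F w2] by blast
      qed
      then show ?thesis using vB w12 by (auto simp: U_def)
    qed
    have rU: "r \<notin> U w1 \<union> U w2"
      using BN[OF _ rN] w12 \<open>v \<noteq> r\<close> by (auto simp: U_def)
    have Nw: "x = r \<or> x = w1 \<or> x = w2" if "x \<in> N" for x using that w(1) by blast
    have V: "V = insert r (U w1 \<union> U w2)"
    proof
      \<comment> \<open>Closure under adjacency again exhausts \<open>V\<close> by
        connectedness.\<close>
      have "symcl A `` insert r (U w1 \<union> U w2) \<subseteq> insert r (U w1 \<union> U w2)"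
      proof
        fix y assume "y \<in> symcl A `` insert r (U w1 \<union> U w2)"
        then obtain x where xy: "(x, y) \<in> symcl A" "x \<in> insert r (U w1 \<union> U w2)" by blast
        then consider "x = r" | "x = v" | "x \<in> B w1" | "x \<in> B w2" by (auto simp: U_def)
        then show "y \<in> insert r (U w1 \<union> U w2)"
        proof cases
          case 1 then show ?thesis using nbr xy by (auto simp: U_def)
        next
          case 2 then show ?thesis using Nw[of y] xy N wB by (auto simp: U_def)
        next
          case 3 then show ?thesis using Bstep[OF 3 xy(1)] w12 by (auto simp: U_def)
        next
          case 4 then show ?thesis using Bstep[OF 4 xy(1)] w12 by (auto simp: U_def)
        qed
      qed
      then show "V \<subseteq> insert r (U w1 \<union> U w2)"
        using rtrancl_closed[OF conn[OF rV], of _ "insert r (U w1 \<union> U w2)"] by (simp add: subsetI)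
      show "insert r (U w1 \<union> U w2) \<subseteq> V"
        using BV w12 rV vV by (auto simp: U_def)
    qed
    have A: "A = insert (root_arc b r v) (E w1 \<union> E w2)"
    proof
      show "A \<subseteq> insert (root_arc b r v) (E w1 \<union> E w2)"
      proof
        fix e assume e: "e \<in> A"
        obtain x y where xy: "e = (x, y)" by (cases e)
        then have s: "(x, y) \<in> symcl A" using e by (simp add: symcl_iff)
        show "e \<in> insert (root_arc b r v) (E w1 \<union> E w2)"
        proof (cases "x = r \<or> y = r")
          case True
          then show ?thesis using arc_eq e xy by blast
        next
          case False
          have "x \<in> V" using s subs by auto
          then consider "x = v" | "x \<in> B w1" | "x \<in> B w2"
            using V False by (auto simp: U_def)
          then have "x \<in> U w1 \<and> y \<in> U w1 \<or> x \<in> U w2 \<and> y \<in> U w2"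
          proof cases
            case 1 then show ?thesis using Nw[of y] s N wB False by (auto simp: U_def)
          next
            case 2 then show ?thesis using Bstep[OF 2 s] w12 by (auto simp: U_def)
          next
            case 3 then show ?thesis using Bstep[OF 3 s] w12 by (auto simp: U_def)
          qed
          then show ?thesis using e xy by (auto simp: E_def)
        qed
      qed
    qed (use arc in \<open>auto simp: E_def\<close>)
    \<comment> \<open>The saddle \<open>v\<close> has an arc on the side that the root arc does not
      occupy. Its other end cannot be \<open>r\<close>, so it is \<open>w1\<close> or
      \<open>w2\<close>.\<close>
    have flags: "((v, w1) \<in> A) = b \<or> ((v, w2) \<in> A) = b"
    proof (cases b)
      case True
      then have "(v, r) \<notin> A"
        using arc bridged_one_direction[OF br] by (simp add: root_arc_def)
      moreover obtain y where "(v, y) \<in> A" using sad[OF vV branching] by blast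
      moreover have "y \<in> N" using calculation N by (simp add: symcl_iff)
      ultimately show ?thesis using Nw[of y] True by auto
    next
      case False
      then have "(r, v) \<notin> A"
        using arc bridged_one_direction[OF br] by (simp add: root_arc_def)
      moreover obtain y where y: "(y, v) \<in> A" using sad[OF vV branching] by blast
      moreover have "y \<in> N" using y N by (simp add: symcl_iff)
      moreover have "(v, y) \<notin> A" using y bridged_one_direction[OF br] by blast
      ultimately show ?thesis using Nw[of y] False by auto
    qed
    show ?thesis
      using has_code.saddle[OF t1 t2 flags int rU] unfolding V[symmetric] A[symmetric] by blast
  qed
qed

section \<open>Counting\<close>

text \<open>The classes are exactly the nonempty fibres of the complete invariant
  \<open>f\<close>.\<close>

lemma card_quotient_kernel:
  assumes "equiv S R" "\<And>x y. x \<in> S \<Longrightarrow> y \<in> S \<Longrightarrow> (x, y) \<in> R \<longleftrightarrow> f x = f y"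
  shows "card (S // R) = card (f ` S)"
proof -
  let ?g = "\<lambda>t. {x \<in> S. f x = t}"
  have "R `` {x} = ?g (f x)" if "x \<in> S" for x
    using assms that equiv_type[OF assms(1)] by auto
  then have "S // R = ?g ` f ` S"
    unfolding quotient_def image_image by auto
  moreover have "inj_on ?g (f ` S)"
    by (rule inj_onI) blast
  ultimately show ?thesis by (simp add: card_image)
qed

section \<open>From isomorphism classes to codes\<close>

definition codes :: "nat \<Rightarrow> code set" where
  "codes k = {t. valid_code k t}"

lemma reeb_graphs_iff_planted_reeb:
  "(G, r) \<in> reeb_graphs k \<longleftrightarrow>
    planted_reeb True (pverts G) (parcs G) r \<and> card {x \<in> pverts G. deg (parcs G) x = 3} = k"
  by (simp add: reeb_graphs_def rooted_oriented_reeb_graph_iff saddles_def degree_eq_deg)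

definition graph_code :: "nat pair_pre_digraph \<times> nat \<Rightarrow> code" where
  "graph_code X = (THE t. has_code True (pverts (fst X)) (parcs (fst X)) (snd X) t)"

lemma graph_code_eqI:
  assumes "has_code True (pverts G) (parcs G) r t" shows "graph_code (G, r) = t"
  unfolding graph_code_def fst_conv snd_conv
  by (rule the_equality) (use assms has_code_deterministic in metis)+

lemma has_code_graph_code:
  assumes "(G, r) \<in> reeb_graphs k"
  shows "has_code True (pverts G) (parcs G) r (graph_code (G, r))" "graph_code (G, r) \<in> codes k"
proof -
  obtain t where t: "has_code True (pverts G) (parcs G) r t"
    using planted_reeb_imp_has_code[of True "pverts G" "parcs G" r] assms
    unfolding reeb_graphs_iff_planted_reeb by blast
  then show "has_code True (pverts G) (parcs G) r (graph_code (G, r))"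
    by (simp add: graph_code_eqI)
  from has_code_imp_planted_reeb[OF this] show "graph_code (G, r) \<in> codes k"
    using assms unfolding reeb_graphs_iff_planted_reeb codes_def by simp
qed

lemma image_graph_code: "graph_code ` reeb_graphs k = codes k"
proof
  show "graph_code ` reeb_graphs k \<subseteq> codes k"
    using has_code_graph_code(2) by auto
  show "codes k \<subseteq> graph_code ` reeb_graphs k"
  proof
    fix t assume t: "t \<in> codes k"
    obtain V A and r :: nat where R: "has_code True V A r t"
      using has_code_exists t unfolding codes_def by blast
    let ?G = "\<lparr>pverts = V, parcs = A\<rparr>"
    have code: "graph_code (?G, r) = t"
      using R by (intro graph_code_eqI) simp
    have P: "planted_reeb True V A r" "valid_code (card {x \<in> V. deg A x = 3}) t"
      using has_code_imp_planted_reeb[OF R] by auto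
    \<comment> \<open>The code is valid both for \<open>k\<close> and for the saddle number of the
      constructed graph, and a code determines its index.\<close>
    have "card {x \<in> V. deg A x = 3} = k"
      using valid_code_unique[OF P(2)] t by (simp add: codes_def)
    then have "(?G, r) \<in> reeb_graphs k"
      using P(1) by (simp add: reeb_graphs_iff_planted_reeb)
    then show "t \<in> graph_code ` reeb_graphs k" using code by force
  qed
qed

text \<open>The code is an invariant because derivations transport along injections and codes are
  unique. It is complete because graphs with equal codes are isomorphic.\<close>

lemma reeb_iso_rel_iff_graph_code:
  assumes "X \<in> reeb_graphs k" "Y \<in> reeb_graphs k"
  shows "(X, Y) \<in> reeb_iso_rel k \<longleftrightarrow> graph_code X = graph_code Y"
proof -
  obtain G r where X: "X = (G, r)" by (cases X)
  obtain H s where Y: "Y = (H, s)" by (cases Y)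
  note G = has_code_graph_code(1)[OF assms(1)[unfolded X]]
  note H = has_code_graph_code(1)[OF assms(2)[unfolded Y]]
  have "rooted_oriented_reeb_graph G r"
    using assms(1) X by (simp add: reeb_graphs_def)
  then interpret rooted_oriented_reeb_graph G r .
  have "(X, Y) \<in> reeb_iso_rel k \<longleftrightarrow>
      (\<exists>\<phi>. planted_iso \<phi> (pverts G) (parcs G) r (pverts H) (parcs H) s)"
    using assms unfolding reeb_iso_rel_def X Y planted_iso_def
    by (simp add: rooted_iso_iff[OF pair_wf_digraph_axioms])
  also have "\<dots> \<longleftrightarrow> graph_code X = graph_code Y"
  proof
    assume "\<exists>\<phi>. planted_iso \<phi> (pverts G) (parcs G) r (pverts H) (parcs H) s"
    then obtain \<phi> where \<phi>: "inj_on \<phi> (pverts G)" "\<phi> ` pverts G = pverts H"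
      "map_prod \<phi> \<phi> ` parcs G = parcs H" "\<phi> r = s"
      by (auto simp: planted_iso_def bij_betw_def)
    from has_code_image[OF G \<phi>(1)] have "has_code True (pverts H) (parcs H) s (graph_code (G, r))"
      unfolding \<phi> .
    then show "graph_code X = graph_code Y"
      using has_code_deterministic[OF _ H] X Y by simp
  next
    assume "graph_code X = graph_code Y"
    then show "\<exists>\<phi>. planted_iso \<phi> (pverts G) (parcs G) r (pverts H) (parcs H) s"
      using has_code_same_code_iso[OF G] H X Y by simp
  qed
  finally show ?thesis .
qed

lemma K_eq_card_codes: "K k = card (codes k)"
  unfolding K_def image_graph_code[symmetric]
  by (rule card_quotient_kernel[OF equiv_reeb_iso_rel reeb_iso_rel_iff_graph_code])

lemma codes_0: "codes 0 = {Code {#}}"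
proof -
  have "t = Code {#}" if "valid_code 0 t" for t
    using that by cases auto
  then show ?thesis by (auto simp: codes_def valid_code.intros)
qed

section \<open>The recurrence for the number of codes\<close>

definition code_pairs :: "nat \<Rightarrow> (code \<times> code) set" where
  "code_pairs k = (\<Union>i\<le>k. codes i \<times> codes (k - i))"

lemma mem_code_pairs: "(s, t) \<in> code_pairs k \<longleftrightarrow> (\<exists>i j. i + j = k \<and> valid_code i s \<and> valid_code j t)"
proof
  assume "(s, t) \<in> code_pairs k"
  then obtain i where "i \<le> k" "valid_code i s" "valid_code (k - i) t"
    by (auto simp: code_pairs_def codes_def)
  then show "\<exists>i j. i + j = k \<and> valid_code i s \<and> valid_code j t"
    by (intro exI[of _ i] exI[of _ "k - i"]) simp
next
  assume "\<exists>i j. i + j = k \<and> valid_code i s \<and> valid_code j t"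
  then obtain i j where "i + j = k" "valid_code i s" "valid_code j t" by blast
  then have "i \<in> {..k}" "(s, t) \<in> codes i \<times> codes (k - i)" by (auto simp: codes_def)
  then show "(s, t) \<in> code_pairs k" unfolding code_pairs_def by (rule UN_I)
qed

lemma code_pairs_commute: "(s, t) \<in> code_pairs k \<Longrightarrow> (t, s) \<in> code_pairs k"
  unfolding mem_code_pairs using add.commute by metis

lemma codes_Suc:
  "codes (Suc k) = (\<lambda>(s, t). Code {#(True, s), (False, t)#}) ` code_pairs k \<union>
    (\<lambda>(s, t). Code {#(True, s), (True, t)#}) ` code_pairs k" (is "_ = ?R")
proof
  show "codes (Suc k) \<subseteq> ?R"
  proof
    fix u assume "u \<in> codes (Suc k)"
    then have "valid_code (Suc k) u" by (simp add: codes_def)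
    then show "u \<in> ?R"
    proof cases
      case (2 i s j t c d)
      then have st: "(s, t) \<in> code_pairs k" "(t, s) \<in> code_pairs k"
        using mem_code_pairs code_pairs_commute by blast+
      consider "c" "d" | "c" "\<not> d" | "\<not> c" "d" using 2 by blast
      then show ?thesis
      proof cases
        case 1
        then have "u = (\<lambda>(s, t). Code {#(True, s), (True, t)#}) (s, t)" using 2 by simp
        then show ?thesis using st(1) by blast
      next
        case 2
        then have "u = (\<lambda>(s, t). Code {#(True, s), (False, t)#}) (s, t)" using \<open>u = _\<close> by simp
        then show ?thesis using st(1) by blast
      next
        case 3
        \<comment> \<open>The multiset ignores order, so the branch with flag \<open>True\<close>
          may be listed first.\<close>
        then have "u = (\<lambda>(s, t). Code {#(True, s), (False, t)#}) (t, s)"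
          using \<open>u = _\<close> by (simp add: add_mset_commute)
        then show ?thesis using st(2) by blast
      qed
    qed
  qed
  show "?R \<subseteq> codes (Suc k)"
    by (auto simp: codes_def mem_code_pairs intro!: valid_code.intros(2))
qed

lemma finite_codes: "finite (codes k)"
proof (induction k rule: less_induct)
  case (less k)
  show ?case
  proof (cases k)
    case 0
    then show ?thesis by (simp add: codes_0)
  next
    case (Suc m)
    have "finite (code_pairs m)"
      unfolding code_pairs_def using less Suc by (intro finite_UN_I finite_cartesian_product) auto
    then show ?thesis by (simp add: Suc codes_Suc)
  qed
qed

lemma finite_code_pairs: "finite (code_pairs k)"
  unfolding code_pairs_def using finite_codes by (intro finite_UN_I finite_cartesian_product) auto

lemma codes_disjoint: "i \<noteq> j \<Longrightarrow> codes i \<inter> codes j = {}"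
  using valid_code_unique by (auto simp: codes_def)

lemma card_code_pairs: "card (code_pairs k) = (\<Sum>i\<le>k. K i * K (k - i))"
proof -
  have "card (code_pairs k) = (\<Sum>i\<le>k. card (codes i \<times> codes (k - i)))"
    unfolding code_pairs_def
    by (rule card_UN_disjoint) (use finite_codes codes_disjoint in blast)+
  then show ?thesis by (simp add: card_cartesian_product K_eq_card_codes)
qed

text \<open>Equal codes have equally many saddles, so a diagonal pair splits \<open>k\<close> into
  two equal halves.\<close>

lemma diagonal_code_pairs:
  "{p \<in> code_pairs k. fst p = snd p} = (if even k then (\<lambda>t. (t, t)) ` codes (k div 2) else {})"
proof -
  have "(t, t) \<in> code_pairs k \<longleftrightarrow> even k \<and> t \<in> codes (k div 2)" for t
  proof
    assume "(t, t) \<in> code_pairs k"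
    then obtain i j where ij: "i + j = k" "valid_code i t" "valid_code j t"
      unfolding mem_code_pairs by blast
    then have "i = j" using valid_code_unique by blast
    then show "even k \<and> t \<in> codes (k div 2)" using ij by (auto simp: codes_def)
  next
    assume "even k \<and> t \<in> codes (k div 2)"
    then have "k div 2 + k div 2 = k" "valid_code (k div 2) t" by (auto simp: codes_def)
    then show "(t, t) \<in> code_pairs k" unfolding mem_code_pairs by blast
  qed
  then show ?thesis by (auto simp: image_iff split: prod.splits)
qed

lemma card_unordered_pairs:
  assumes "finite T" "\<And>a b. (a, b) \<in> T \<Longrightarrow> (b, a) \<in> T"
    and "\<And>a b a' b'. h (a, b) = h (a', b') \<longleftrightarrow> a = a' \<and> b = b' \<or> a = b' \<and> b = a'"
  shows "2 * card (h ` T) = card T + card {p \<in> T. fst p = snd p}"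
proof -
  \<comment> \<open>A fibre of \<open>h\<close> has two elements off the diagonal, one on it.\<close>
  have fibre: "card {p \<in> T. h p = y} + card {p \<in> T. fst p = snd p \<and> h p = y} = 2"
    if y: "y \<in> h ` T" for y
  proof -
    obtain a b where ab: "(a, b) \<in> T" "y = h (a, b)" using y by auto
    have 1: "{p \<in> T. h p = y} = {(a, b), (b, a)}"
      using ab assms(2,3) by auto
    have 2: "{p \<in> T. fst p = snd p \<and> h p = y} = (if a = b then {(a, b)} else {})"
      using ab assms(3) by auto
    show ?thesis unfolding 1 2 by simp
  qed
  let ?D = "{p \<in> T. fst p = snd p}"
  have "card T = (\<Sum>y\<in>h ` T. card {p \<in> T. h p = y})"
    unfolding card_eq_sum by (rule sum.image_gen[OF assms(1)])
  moreover have "card ?D = (\<Sum>y\<in>h ` T. card {p \<in> ?D. h p = y})"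
    unfolding card_eq_sum by (rule sum.group[symmetric]) (use assms(1) in auto)
  ultimately have "card T + card ?D = (\<Sum>y\<in>h ` T. 2)"
    using fibre by (simp add: sum.distrib[symmetric] conj_ac)
  then show ?thesis by simp
qed

text \<open>With P ordered pairs and D diagonal ones, mixed flags contribute P codes and equal flags
  half of P + D. Doubling gives 3P + D and avoids division.\<close>

lemma K_recurrence:
  "2 * K (Suc k) = 3 * (\<Sum>i\<le>k. K i * K (k - i)) + (if even k then K (k div 2) else 0)"
proof -
  let ?M = "\<lambda>(s, t). Code {#(True, s), (False, t)#}"
  let ?D = "\<lambda>(s, t). Code {#(True, s), (True, t)#}"
  \<comment> \<open>Different flags tell the two branches apart, so the ordered pair can be
    recovered from the multiset.\<close>
  have "card (?M ` code_pairs k) = card (code_pairs k)"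
    by (rule card_image) (auto simp: inj_on_def add_eq_conv_ex add_mset_eq_singleton_iff)
  moreover have "?M ` code_pairs k \<inter> ?D ` code_pairs k = {}"
    by (auto simp: add_eq_conv_ex add_mset_eq_singleton_iff)
  moreover have "2 * card (?D ` code_pairs k) =
      card (code_pairs k) + card {p \<in> code_pairs k. fst p = snd p}"
    by (rule card_unordered_pairs[OF finite_code_pairs code_pairs_commute])
      (auto simp: add_eq_conv_ex add_mset_eq_singleton_iff)
  moreover have "card {p \<in> code_pairs k. fst p = snd p} = (if even k then K (k div 2) else 0)"
    unfolding diagonal_code_pairs K_eq_card_codes by (simp add: card_image inj_on_def)
  ultimately show ?thesis
    unfolding K_eq_card_codes[of "Suc k"] codes_Suc
    by (simp add: card_Un_disjoint finite_code_pairs card_code_pairs[symmetric])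
qed

text \<open>Reversing the index swaps the two factors and exchanges the lower and upper halves of
  the range. In the second sum the index \<open>n\<close> is its own mirror image and gives the
  square.\<close>

lemma sum_symmetric_half:
  fixes f :: "nat \<Rightarrow> 'a::comm_semiring_1"
  shows "(\<Sum>i<2 * n. f i * f (2 * n - 1 - i)) = 2 * (\<Sum>i<n. f i * f (2 * n - 1 - i))"
    and "(\<Sum>i\<le>2 * n. f i * f (2 * n - i)) = 2 * (\<Sum>i<n. f i * f (2 * n - i)) + f n * f n"
proof -
  have "{..<2 * n} = {..<n} \<union> {n..<2 * n}" by auto
  then have "(\<Sum>i<2 * n. f i * f (2 * n - 1 - i)) =
      (\<Sum>i<n. f i * f (2 * n - 1 - i)) + (\<Sum>i=n..<2 * n. f i * f (2 * n - 1 - i))"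
    by (simp add: sum.union_disjoint ivl_disj_int)
  also have "(\<Sum>i=n..<2 * n. f i * f (2 * n - 1 - i)) = (\<Sum>i<n. f i * f (2 * n - 1 - i))"
    by (rule sum.reindex_bij_witness[of _ "\<lambda>i. 2 * n - 1 - i" "\<lambda>i. 2 * n - 1 - i"])
      (auto simp: mult.commute)
  finally show "(\<Sum>i<2 * n. f i * f (2 * n - 1 - i)) = 2 * (\<Sum>i<n. f i * f (2 * n - 1 - i))"
    by (simp add: mult_2)
  have "{..2 * n} = insert n ({..<n} \<union> {n<..2 * n})" "{..<n} \<inter> {n<..2 * n} = {}" by auto
  then have "(\<Sum>i\<le>2 * n. f i * f (2 * n - i)) =
      f n * f n + ((\<Sum>i<n. f i * f (2 * n - i)) + (\<Sum>i\<in>{n<..2 * n}. f i * f (2 * n - i)))"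
    by (simp add: sum.union_disjoint ivl_disj_int)
  also have "(\<Sum>i\<in>{n<..2 * n}. f i * f (2 * n - i)) = (\<Sum>i<n. f i * f (2 * n - i))"
    by (rule sum.reindex_bij_witness[of _ "\<lambda>i. 2 * n - i" "\<lambda>i. 2 * n - i"])
      (auto simp: mult.commute)
  finally show "(\<Sum>i\<le>2 * n. f i * f (2 * n - i)) = 2 * (\<Sum>i<n. f i * f (2 * n - i)) + f n * f n"
    by (simp add: mult_2 add_ac)
qed

theorem theorem3:
  shows "K 0 = 1
    \<and> (\<forall>n\<ge>1. K (2 * n) = 3 * (\<Sum>i<n. K i * K (2 * n - 1 - i)))
    \<and> (\<forall>n. real (K (2 * n + 1)) =
          3 * (\<Sum>i<n. real (K i) * real (K (2 * n - i)))
          + (3 * (real (K n))\<^sup>2 + real (K n)) / 2)"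
proof (intro conjI allI impI)
  show "K 0 = 1" by (simp add: K_eq_card_codes codes_0)
  fix n :: nat
  show "K (2 * n) = 3 * (\<Sum>i<n. K i * K (2 * n - 1 - i))" if "1 \<le> n"
  proof -
    \<comment> \<open>For \<open>n \<ge> 1\<close> the truncated subtraction is exact. As
      \<open>2 * n - 1\<close> is odd, there is no diagonal term, and the factor 2 from halving the
      sum cancels.\<close>
    have "Suc (2 * n - 1) = 2 * n" "odd (2 * n - 1)" "{..2 * n - 1} = {..<2 * n}"
      using that by auto
    with K_recurrence[of "2 * n - 1"] sum_symmetric_half(1)[of K n] show ?thesis by simp
  qed
  \<comment> \<open>The square is the middle term of the symmetric sum, and the linear
    \<open>K n\<close> counts the diagonal pairs. The equation stays doubled in \<open>nat\<close>;
    division by 2 follows over the reals.\<close>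
  have "2 * K (2 * n + 1) = 6 * (\<Sum>i<n. K i * K (2 * n - i)) + 3 * (K n)\<^sup>2 + K n"
    using K_recurrence[of "2 * n"] sum_symmetric_half(2)[of K n] by (simp add: power2_eq_square)
  from arg_cong[OF this, of real] have "2 * real (K (2 * n + 1)) =
      6 * (\<Sum>i<n. real (K i) * real (K (2 * n - i))) + 3 * (real (K n))\<^sup>2 + real (K n)"
    by simp
  then show "real (K (2 * n + 1)) = 3 * (\<Sum>i<n. real (K i) * real (K (2 * n - i)))
      + (3 * (real (K n))\<^sup>2 + real (K n)) / 2"
    by (simp add: field_simps)
qed

end
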